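(* Let $d$ be the smallest positive integer, not a multiple of $3$, for which there exists an algebraic number over $\mathbb{Q}$ of degree $d$ such that some three distinct algebraic conjugates of it (over $\mathbb{Q}$) sum to zero. Then $d=20$.
   Context: An algebraic number $\alpha\in\mathbb{C}$ has degree $d$ if its minimal polynomial over $\mathbb{Q}$ has degree $d$. The algebraic conjugates of $\alpha$ are the $d$ (distinct) complex roots of this minimal polynomial, $\alpha$ itself included. *)

theory Defs
  imports "HOL-Computational_Algebra.Computational_Algebra"
begin

abbreviation complex_poly :: "rat poly \<Rightarrow> complex poly" where
  "complex_poly p \<equiv> map_poly of_rat p"

text \<open>
  The value is meaningful only for algebraic arguments, for which the description is unique;
  see \<open>min_poly_rat_ex1\<close> and \<open>min_poly_rat_dvd_iff\<close> below.
\<close>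

definition min_poly_rat :: "complex \<Rightarrow> rat poly" where
  "min_poly_rat \<alpha> =
     (THE p. lead_coeff p = 1 \<and> irreducible p \<and> poly (complex_poly p) \<alpha> = 0)"

definition alg_degree :: "complex \<Rightarrow> nat" where
  "alg_degree \<alpha> = degree (min_poly_rat \<alpha>)"

definition alg_conjugates :: "complex \<Rightarrow> complex set" where
  "alg_conjugates \<alpha> = {z. poly (complex_poly (min_poly_rat \<alpha>)) z = 0}"

definition three_conjugates_sum_zero :: "complex \<Rightarrow> bool" where
  "three_conjugates_sum_zero \<alpha> \<longleftrightarrow>
     (\<exists>x\<in>alg_conjugates \<alpha>. \<exists>y\<in>alg_conjugates \<alpha>. \<exists>z\<in>alg_conjugates \<alpha>.
        x \<noteq> y \<and> x \<noteq> z \<and> y \<noteq> z \<and> x + y + z = 0)"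

lemma complex_poly_add: "complex_poly (p + q) = complex_poly p + complex_poly q"
  by (rule poly_eqI) (simp add: coeff_map_poly of_rat_add)

lemma complex_poly_mult: "complex_poly (p * q) = complex_poly p * complex_poly q"
  by (rule poly_eqI) (simp add: coeff_map_poly coeff_mult of_rat_sum of_rat_mult)

lemma complex_poly_pderiv: "complex_poly (pderiv p) = pderiv (complex_poly p)"
  by (rule poly_eqI) (simp add: coeff_map_poly coeff_pderiv of_rat_mult of_rat_add)

lemma degree_complex_poly [simp]: "degree (complex_poly p) = degree p"
  by (rule degree_map_poly) simp

lemma complex_poly_dvd_root:
  "p dvd q \<Longrightarrow> poly (complex_poly p) x = 0 \<Longrightarrow> poly (complex_poly q) x = 0"
  by (auto simp: complex_poly_mult elim!: dvdE)

lemma least_degree_root_dvd: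
  fixes x :: complex
  assumes "q0 \<noteq> 0" "poly (complex_poly q0) x = 0"
  obtains m where "m \<noteq> 0" "poly (complex_poly m) x = 0"
    "\<And>q. poly (complex_poly q) x = 0 \<Longrightarrow> m dvd q"
proof -
  let ?Q = "\<lambda>p. p \<noteq> 0 \<and> poly (complex_poly p) x = 0"
  define m where "m = arg_min degree ?Q"
  have m: "m \<noteq> 0" "poly (complex_poly m) x = 0"
    using arg_min_natI[of ?Q q0 degree] assms unfolding m_def by blast+
  have least: "degree m \<le> degree q" if "?Q q" for q
    using arg_min_nat_le[of ?Q q degree] that unfolding m_def by blast
  have "m dvd q" if q: "poly (complex_poly q) x = 0" for q
  proof -
    have "complex_poly q = complex_poly (q div m) * complex_poly m + complex_poly (q mod m)"
      by (simp flip: complex_poly_add complex_poly_mult)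
    with q m have "poly (complex_poly (q mod m)) x = 0"
      by simp
    then have "q mod m = 0"
      using least[of "q mod m"] degree_mod_less'[of m q] m(1) by force
    then show ?thesis
      by (simp add: mod_eq_0_iff_dvd)
  qed
  with m that show ?thesis
    by blast
qed

lemma irreducible_root_dvd:
  fixes p q :: "rat poly"
  assumes "irreducible p" "poly (complex_poly p) x = 0" "poly (complex_poly q) x = 0"
  shows "p dvd q"
proof -
  have "p \<noteq> 0" using assms(1) by auto
  then obtain m where m: "poly (complex_poly m) x = 0"
    "\<And>q. poly (complex_poly q) x = 0 \<Longrightarrow> m dvd q"
    using least_degree_root_dvd assms(2) by blast
  have "\<not> m dvd 1"
    using complex_poly_dvd_root[OF _ m(1), of 1] by auto
  with m(2)[OF assms(2)] assms(1) have "p dvd m"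
    by (auto simp: irreducible_altdef)
  with m(2)[OF assms(3)] show ?thesis
    using dvd_trans by blast
qed

lemma min_poly_rat_ex1:
  assumes "algebraic \<alpha>"
  shows "\<exists>!p. lead_coeff p = 1 \<and> irreducible p \<and> poly (complex_poly p) \<alpha> = 0"
proof (rule ex_ex1I)
  obtain P where P: "\<And>i. coeff P i \<in> \<rat>" "P \<noteq> 0" "poly P \<alpha> = 0"
    using assms unfolding algebraic_altdef by blast
  obtain p0 where "P = complex_poly p0"
    using P(1) by (rule ratpolyE)
  with P have "p0 \<noteq> 0" "poly (complex_poly p0) \<alpha> = 0"
    by auto
  then obtain p where p: "p \<noteq> 0" "poly (complex_poly p) \<alpha> = 0"
    and dvd: "\<And>q. poly (complex_poly q) \<alpha> = 0 \<Longrightarrow> p dvd q"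
    using least_degree_root_dvd by blast
  have least: "degree p \<le> degree q" if "q \<noteq> 0" "poly (complex_poly q) \<alpha> = 0" for q
    using dvd that dvd_imp_degree_le by blast
  have irr: "irreducible p"
  proof (rule irreducibleI)
    show "p \<noteq> 0" by fact
    show "\<not> p dvd 1"
    proof
      assume "p dvd 1"
      from complex_poly_dvd_root[OF this p(2)] show False by simp
    qed
    fix a b assume ab: "p = a * b"
    then have nz: "a \<noteq> 0" "b \<noteq> 0" and deg: "degree p = degree a + degree b"
      using p(1) by (auto simp: degree_mult_eq)
    have "poly (complex_poly a) \<alpha> = 0 \<or> poly (complex_poly b) \<alpha> = 0"
      using p(2) ab by (simp add: complex_poly_mult)
    then have "degree a = 0 \<or> degree b = 0"
      using least[of a] least[of b] nz deg by auto
    then show "a dvd 1 \<or> b dvd 1"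
      using nz by (simp add: is_unit_iff_degree)
  qed
  let ?n = "smult (inverse (lead_coeff p)) p"
  have "lead_coeff ?n = 1" using p(1) by simp
  moreover have "irreducible ?n"
  proof -
    have "[:inverse (lead_coeff p):] dvd 1"
      using p(1) by (simp add: is_unit_iff_degree)
    with irr show ?thesis
      using irreducible_mult_unit_left[of "[:inverse (lead_coeff p):]" p] by simp
  qed
  moreover have "poly (complex_poly ?n) \<alpha> = 0"
    by (rule complex_poly_dvd_root[OF _ p(2)]) (simp add: dvd_smult)
  ultimately show "\<exists>p. lead_coeff p = 1 \<and> irreducible p \<and> poly (complex_poly p) \<alpha> = 0"
    by blast
next
  fix p q :: "rat poly"
  assume p: "lead_coeff p = 1 \<and> irreducible p \<and> poly (complex_poly p) \<alpha> = 0"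
    and q: "lead_coeff q = 1 \<and> irreducible q \<and> poly (complex_poly q) \<alpha> = 0"
  then have "p dvd q" "q dvd p"
    using irreducible_root_dvd by blast+
  then obtain c where c: "q = p * c" and "degree q \<le> degree p"
    using p by (auto elim!: dvdE[of p] dest!: dvd_imp_degree_le)
  moreover have "c \<noteq> 0" "p \<noteq> 0"
    using c p q by auto
  ultimately have "degree c = 0"
    by (simp add: degree_mult_eq)
  moreover have "lead_coeff c = 1"
    using c p q by (simp add: lead_coeff_mult)
  ultimately have "c = 1"
    by (auto elim!: degree_eq_zeroE)
  with c show "p = q"
    by simp
qed

lemma min_poly_rat:
  assumes "algebraic \<alpha>"
  shows "lead_coeff (min_poly_rat \<alpha>) = 1" "irreducible (min_poly_rat \<alpha>)"
    "poly (complex_poly (min_poly_rat \<alpha>)) \<alpha> = 0"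
  using theI'[OF min_poly_rat_ex1[OF assms]] unfolding min_poly_rat_def by blast+

lemma min_poly_rat_dvd_iff:
  assumes "algebraic \<alpha>"
  shows "min_poly_rat \<alpha> dvd q \<longleftrightarrow> poly (complex_poly q) \<alpha> = 0"
  using irreducible_root_dvd complex_poly_dvd_root min_poly_rat[OF assms] by blast

lemma card_alg_conjugates:
  assumes "algebraic \<alpha>"
  shows "card (alg_conjugates \<alpha>) = alg_degree \<alpha>"
proof -
  let ?p = "min_poly_rat \<alpha>"
  note p = min_poly_rat[OF assms]
  have "?p \<noteq> 0" using p(2) by auto
  have deg: "degree ?p \<noteq> 0"
    using p(2) \<open>?p \<noteq> 0\<close> by (metis irreducible_def is_unit_iff_degree)
  have "\<not> ?p dvd pderiv ?p"
    using deg not_dvd_pderiv by blast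
  then have "rsquarefree (complex_poly ?p)"
    unfolding rsquarefree_roots complex_poly_pderiv[symmetric]
    using irreducible_root_dvd p(2) by blast
  then have "smult (lead_coeff (complex_poly ?p))
      (\<Prod>z | poly (complex_poly ?p) z = 0. [:- z, 1:]) = complex_poly ?p"
    by (rule complex_poly_decompose_rsquarefree)
  then have "degree (\<Prod>z\<in>alg_conjugates \<alpha>. [:- z, 1:]) = alg_degree \<alpha>"
    unfolding alg_conjugates_def alg_degree_def
    by (metis degree_complex_poly degree_smult_eq degree_0 deg)
  then show ?thesis
    by (subst (asm) degree_prod_eq_sum_degree) simp_all
qed

end

theory Submission
  imports Defs "HOL-Algebra.Sylow" "HOL-Algebra.Group_Action"
begin

text \<open>
  Let \<open>X\<close> be the set of the \<open>d\<close> conjugates of \<open>\<alpha>\<close> and \<open>T\<close> the set of the three-element subsets of \<open>X\<close>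
  with sum zero. The Galois group permutes \<open>X\<close> transitively and preserves \<open>T\<close>
  (\<open>conjugates_automorphism\<close>), and everything else about degrees below \<open>20\<close> is combinatorics of the
  pair \<open>(X, T)\<close> and of its automorphism group \<open>G\<close>.

  The identity on \<open>X\<close> is a nonzero function whose sum over each \<open>t \<in> T\<close> is zero. This is a linear
  system with integer coefficients, so it also has a nonzero solution in integers
  (\<open>integral_solution_exists\<close>) and hence, for every prime \<open>p\<close>, a nonzero solution modulo \<open>p\<close>
  (\<open>nonzero_weighting_exists\<close>). A Sylow \<open>p\<close>-subgroup \<open>H\<close> of \<open>G\<close> acts on the nonzero solutions modulo
  \<open>p\<close>; their number is \<open>-1\<close> modulo \<open>p\<close>, so one of them is fixed by \<open>H\<close>, that is, constant on the orbits
  of \<open>H\<close> in \<open>X\<close> (\<open>p_group_invariant_weighting\<close>). If \<open>p\<^sup>k\<close> divides \<open>d\<close>, then \<open>p\<^sup>k\<close> divides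
  the length of each of these orbits (\<open>primepow_dvd_card_sylow_orbit\<close>).

  Thus \<open>d = p\<^sup>k\<close> with \<open>p \<noteq> 3\<close> is impossible: the fixed solution is a nonzero constant \<open>c\<close>, and the sum
  over a triple is \<open>3 c \<noteq> 0\<close>. If \<open>d = 2 p\<^sup>k\<close> with \<open>p > 3\<close>, there are two orbits of equal length; the
  value of the fixed solution on them determines how many points of a triple lie in the first
  orbit, so that number \<open>j\<close> is the same for all triples, while double counting forces \<open>j = 3 - j\<close>
  (\<open>triple_system_degree\<close>). Every positive \<open>d < 20\<close> that is not a multiple of \<open>3\<close> has one of these two
  forms (\<open>small_degree_cases\<close>).

  Degree \<open>20\<close> occurs for the difference of two distinct fifth roots of \<open>1/5\<close>. For three distinct
  roots \<open>r\<close>, \<open>s\<close>, \<open>t\<close> the differences \<open>r - s\<close>, \<open>s - t\<close>, \<open>t - r\<close> have sum zero, and all such differences are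
  conjugate because they are roots of \<open>x\<^sup>2\<^sup>0 + 25 x\<^sup>1\<^sup>0 + 5\<close>, which is irreducible by Eisenstein's
  criterion (\<open>degree_20_example\<close>).
\<close>

section \<open>Transitivity of the Galois group on conjugates\<close>

text \<open>
  Subfields of \<open>\<complex>\<close> are handled as sets and polynomials over them as complex polynomials with
  coefficients in the set, because the fields in question arise one after another during an
  induction and so cannot be types. Outside \<open>K\<close> the map \<open>\<phi>\<close> is arbitrary.
\<close>

locale embedded_subfield =
  fixes K :: "complex set" and \<phi> :: "complex \<Rightarrow> complex"
  assumes one_closed: "1 \<in> K"
    and diff_closed: "x \<in> K \<Longrightarrow> y \<in> K \<Longrightarrow> x - y \<in> K"
    and mult_closed: "x \<in> K \<Longrightarrow> y \<in> K \<Longrightarrow> x * y \<in> K"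
    and inverse_closed: "x \<in> K \<Longrightarrow> inverse x \<in> K"
    and hom_one: "\<phi> 1 = 1"
    and hom_add: "x \<in> K \<Longrightarrow> y \<in> K \<Longrightarrow> \<phi> (x + y) = \<phi> x + \<phi> y"
    and hom_mult: "x \<in> K \<Longrightarrow> y \<in> K \<Longrightarrow> \<phi> (x * y) = \<phi> x * \<phi> y"
begin

lemma zero_closed: "0 \<in> K"
  using diff_closed[OF one_closed one_closed] by simp

lemma uminus_closed: "x \<in> K \<Longrightarrow> - x \<in> K"
  using diff_closed[OF zero_closed, of x] by simp

lemma add_closed: "x \<in> K \<Longrightarrow> y \<in> K \<Longrightarrow> x + y \<in> K"
  using diff_closed[of x "- y"] uminus_closed[of y] by simp

lemma sum_closed: "(\<And>i. i \<in> I \<Longrightarrow> g i \<in> K) \<Longrightarrow> sum g I \<in> K"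
  by (induction I rule: infinite_finite_induct) (simp_all add: zero_closed add_closed)

lemma of_nat_closed: "of_nat n \<in> K"
  by (induction n) (simp_all add: zero_closed one_closed add_closed)

lemma of_int_closed: "of_int n \<in> K"
  by (cases n rule: int_cases2) (auto simp: of_nat_closed uminus_closed)

lemma Rats_subset: "\<rat> \<subseteq> K"
proof
  fix x :: complex assume "x \<in> \<rat>"
  then obtain a b where "x = of_int a / of_int b"
    by (auto elim!: Rats_cases')
  then show "x \<in> K"
    using mult_closed[OF of_int_closed inverse_closed[OF of_int_closed]]
    by (simp add: field_simps)
qed

lemma hom_zero: "\<phi> 0 = 0"
  using hom_add[OF zero_closed zero_closed] by simp

lemma hom_uminus: "x \<in> K \<Longrightarrow> \<phi> (- x) = - \<phi> x"
  using hom_add[of x "- x"] by (simp add: uminus_closed hom_zero eq_neg_iff_add_eq_0 add.commute)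

lemma hom_sum: "(\<And>i. i \<in> I \<Longrightarrow> g i \<in> K) \<Longrightarrow> \<phi> (sum g I) = (\<Sum>i\<in>I. \<phi> (g i))"
  by (induction I rule: infinite_finite_induct) (simp_all add: hom_zero hom_add sum_closed)

lemma hom_eq_0D: assumes "x \<in> K" "\<phi> x = 0" shows "x = 0"
proof (rule ccontr)
  assume "x \<noteq> 0"
  then have "\<phi> x * \<phi> (inverse x) = 1"
    using hom_mult[OF assms(1) inverse_closed[OF assms(1)]] hom_one by simp
  with assms show False by simp
qed

lemma hom_inj: "inj_on \<phi> K"
proof
  fix x y assume "x \<in> K" "y \<in> K" "\<phi> x = \<phi> y"
  then have "\<phi> (x + - y) = 0"
    by (subst hom_add) (auto simp: hom_uminus uminus_closed)
  then have "x + - y = 0"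
    by (rule hom_eq_0D[rotated]) (intro add_closed uminus_closed \<open>x \<in> K\<close> \<open>y \<in> K\<close>)
  then show "x = y" by simp
qed

lemma hom_of_nat: "\<phi> (of_nat n) = of_nat n"
  by (induction n) (simp_all add: hom_zero hom_one hom_add of_nat_closed one_closed)

lemma hom_of_int: "\<phi> (of_int n) = of_int n"
  by (cases n rule: int_cases2) (auto simp: of_nat_closed hom_uminus hom_of_nat)

lemma hom_Rats: assumes "x \<in> \<rat>" shows "\<phi> x = x"
proof -
  obtain a b where b: "b > 0" and x: "x = of_int a / of_int b"
    using assms by (auto elim!: Rats_cases')
  have "x \<in> K" using assms Rats_subset by blast
  then have "\<phi> x * of_int b = \<phi> (x * of_int b)"
    by (simp add: hom_mult of_int_closed hom_of_int)
  also have "\<dots> = of_int a" using b x by (simp add: hom_of_int)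
  finally have "\<phi> x = of_int a / of_int b" using b by (simp add: eq_divide_eq)
  with x show ?thesis by simp
qed

definition polys :: "complex poly set" where
  "polys = {u. \<forall>i. coeff u i \<in> K}"

lemma polysI: "(\<And>i. coeff u i \<in> K) \<Longrightarrow> u \<in> polys"
  and polysD: "u \<in> polys \<Longrightarrow> coeff u i \<in> K"
  by (auto simp: polys_def)

lemma polys_0: "0 \<in> polys"
  by (simp add: polys_def zero_closed)

lemma polys_pCons: "c \<in> K \<Longrightarrow> u \<in> polys \<Longrightarrow> pCons c u \<in> polys"
  by (auto simp: polys_def coeff_pCons split: nat.splits)

lemma polys_const: "c \<in> K \<Longrightarrow> [:c:] \<in> polys"
  by (intro polys_pCons polys_0)

lemma polys_add: "u \<in> polys \<Longrightarrow> v \<in> polys \<Longrightarrow> u + v \<in> polys"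
  and polys_diff: "u \<in> polys \<Longrightarrow> v \<in> polys \<Longrightarrow> u - v \<in> polys"
  and polys_smult: "c \<in> K \<Longrightarrow> u \<in> polys \<Longrightarrow> smult c u \<in> polys"
  by (simp_all add: polys_def add_closed diff_closed mult_closed)

lemma polys_mult: "u \<in> polys \<Longrightarrow> v \<in> polys \<Longrightarrow> u * v \<in> polys"
  by (auto simp: polys_def coeff_mult intro!: sum_closed mult_closed)

lemma map_hom_add:
  assumes "u \<in> polys" "v \<in> polys"
  shows "map_poly \<phi> (u + v) = map_poly \<phi> u + map_poly \<phi> v"
  using assms by (intro poly_eqI) (simp add: coeff_map_poly hom_zero hom_add polysD)

lemma map_hom_mult:
  assumes "u \<in> polys" "v \<in> polys"
  shows "map_poly \<phi> (u * v) = map_poly \<phi> u * map_poly \<phi> v"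
  using assms
  by (intro poly_eqI)
    (simp add: coeff_map_poly hom_zero coeff_mult hom_sum hom_mult polysD mult_closed)

lemma hom_poly:
  assumes "u \<in> polys" "z \<in> K"
  shows "poly u z \<in> K" "\<phi> (poly u z) = poly (map_poly \<phi> u) (\<phi> z)"
proof -
  have "u \<in> polys \<Longrightarrow> poly u z \<in> K \<and> \<phi> (poly u z) = poly (map_poly \<phi> u) (\<phi> z)"
  proof (induction u)
    case (pCons c u)
    have "c \<in> K" "u \<in> polys"
      using polysD[OF pCons.prems, of 0] polysD[OF pCons.prems, of "Suc _"]
      by (auto intro: polysI)
    with pCons.IH assms(2) show ?case
      by (simp add: map_poly_pCons hom_zero hom_add hom_mult add_closed mult_closed)
  qed (simp add: zero_closed hom_zero)
  with assms show "poly u z \<in> K" "\<phi> (poly u z) = poly (map_poly \<phi> u) (\<phi> z)" by auto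
qed

lemma degree_map_hom: assumes u: "u \<in> polys" shows "degree (map_poly \<phi> u) = degree u"
proof (cases "u = 0")
  case False
  then have "\<phi> (lead_coeff u) \<noteq> 0"
    using hom_eq_0D[OF polysD[OF u]] by (metis leading_coeff_0_iff)
  then show ?thesis
    by (intro antisym degree_le le_degree)
      (auto simp: coeff_map_poly hom_zero coeff_eq_0)
qed simp

lemma polys_division:
  assumes p: "p \<in> polys" "p \<noteq> 0" and u: "u \<in> polys"
  shows "\<exists>q\<in>polys. \<exists>r\<in>polys. u = p * q + r \<and> (r = 0 \<or> degree r < degree p)"
  using u
proof (induction u)
  case 0
  then show ?case using polys_0 by force
next
  case (pCons c u)
  have cu: "c \<in> K" "u \<in> polys"
    using polysD[OF pCons.prems, of 0] polysD[OF pCons.prems, of "Suc _"]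
    by (auto intro: polysI)
  then obtain q r where q: "q \<in> polys" and r: "r \<in> polys" and
    u: "u = p * q + r" and deg: "r = 0 \<or> degree r < degree p"
    using pCons.IH by blast
  define s where "s = pCons c r"
  define e where "e = coeff s (degree p) * inverse (lead_coeff p)"
  have s: "s \<in> polys" unfolding s_def using cu r by (intro polys_pCons)
  have e: "e \<in> K"
    unfolding e_def by (intro mult_closed inverse_closed polysD s p)
  have "degree s \<le> degree p"
    using deg unfolding s_def by (auto simp: degree_pCons_eq_if)
  then have "degree (s - smult e p) \<le> degree p"
    by (intro degree_diff_le) (auto intro: order.trans[OF degree_smult_le])
  moreover have "coeff (s - smult e p) (degree p) = 0"
    using p(2) by (simp add: e_def)
  ultimately have "s - smult e p = 0 \<or> degree (s - smult e p) < degree p"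
    by (metis eq_zero_or_degree_less)
  moreover have "pCons c u = p * (pCons 0 q + [:e:]) + (s - smult e p)"
    by (simp add: u s_def algebra_simps)
  moreover have "pCons 0 q + [:e:] \<in> polys" "s - smult e p \<in> polys"
    by (intro polys_add polys_pCons polys_diff polys_smult polys_0 zero_closed q e s p)+
  ultimately show ?case by blast
qed

lemma minimal_polynomial_exists:
  assumes "u \<in> polys" "u \<noteq> 0" "poly u a = 0"
  obtains m where "m \<in> polys" "m \<noteq> 0" "poly m a = 0"
    "\<And>v. v \<in> polys \<Longrightarrow> poly v a = 0 \<Longrightarrow> \<exists>q\<in>polys. v = m * q"
proof -
  let ?Q = "\<lambda>p. p \<in> polys \<and> p \<noteq> 0 \<and> poly p a = 0"
  define m where "m = arg_min degree ?Q"
  have m: "?Q m"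
    using arg_min_natI[of ?Q u degree] assms unfolding m_def by blast
  have least: "degree m \<le> degree q" if "?Q q" for q
    using arg_min_nat_le[of ?Q q degree] that unfolding m_def by blast
  have "\<exists>q\<in>polys. v = m * q" if v: "v \<in> polys" "poly v a = 0" for v
  proof -
    obtain q r where qr: "q \<in> polys" "r \<in> polys" "v = m * q + r" "r = 0 \<or> degree r < degree m"
      using polys_division[of m v] m v by blast
    then have "poly r a = 0" using m v by simp
    then have "r = 0" using qr least[of r] by force
    with qr show ?thesis by auto
  qed
  with m that show ?thesis by blast
qed

text \<open>
  The elements of \<open>K(a)\<close> are the values \<open>u(a)\<close> of polynomials \<open>u\<close> over \<open>K\<close>, and \<open>u(a) \<mapsto> (\<phi> u)(b)\<close> does
  not depend on the choice of \<open>u\<close>: two choices differ by a multiple of the minimal polynomial \<open>m\<close>,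
  and \<open>\<phi> m\<close> vanishes at \<open>b\<close>.
\<close>

lemma extend_to_simple_extension:
  assumes m: "m \<in> polys" "m \<noteq> 0" "poly m a = 0"
    and m_dvd: "\<And>v. v \<in> polys \<Longrightarrow> poly v a = 0 \<Longrightarrow> \<exists>q\<in>polys. v = m * q"
    and b: "poly (map_poly \<phi> m) b = 0"
  shows "\<exists>K' \<phi>'. embedded_subfield K' \<phi>' \<and> K \<subseteq> K' \<and> a \<in> K' \<and> \<phi>' a = b \<and> (\<forall>x\<in>K. \<phi>' x = \<phi> x)"
proof -
  define K' where "K' = (\<lambda>u. poly u a) ` polys"
  define \<phi>' where "\<phi>' = (\<lambda>w. poly (map_poly \<phi> (SOME u. u \<in> polys \<and> poly u a = w)) b)"
  have \<phi>': "\<phi>' (poly u a) = poly (map_poly \<phi> u) b" if u: "u \<in> polys" for u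
  proof -
    define v where "v = (SOME v. v \<in> polys \<and> poly v a = poly u a)"
    have v: "v \<in> polys" "poly v a = poly u a"
      using someI[of "\<lambda>v. v \<in> polys \<and> poly v a = poly u a" u] u by (auto simp: v_def)
    obtain q where q: "q \<in> polys" "v - u = m * q"
      using m_dvd[of "v - u"] u v by (auto simp: polys_diff)
    then have "v = u + m * q" by (simp add: algebra_simps)
    then have "map_poly \<phi> v = map_poly \<phi> u + map_poly \<phi> m * map_poly \<phi> q"
      using u q m by (simp add: map_hom_add map_hom_mult polys_mult)
    with b show ?thesis by (simp add: \<phi>'_def v_def[symmetric])
  qed
  have inv: "inverse (poly u a) \<in> K'" if u: "u \<in> polys" for u
  proof (cases "poly u a = 0")
    case True
    then show ?thesis unfolding K'_def by (intro image_eqI[of _ _ 0] polys_0) simp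
  next
    case False
    \<comment> \<open>A generator \<open>g\<close> of the ideal \<open>(u, m)\<close> does not vanish at \<open>a\<close> since it divides \<open>u\<close>. As it also
      divides the minimal polynomial \<open>m\<close>, it is a constant, and Bezout's identity inverts \<open>u(a)\<close>.\<close>
    let ?I = "\<lambda>g. g \<noteq> 0 \<and> (\<exists>s\<in>polys. \<exists>t\<in>polys. g = u * s + m * t)"
    have one: "1 \<in> polys" using polys_const[OF one_closed] by (simp add: one_pCons)
    have "m = u * 0 + m * 1" by simp
    then have Im: "?I m" using m(2) one polys_0 by blast
    define g where "g = arg_min degree ?I"
    have "?I g"
      using arg_min_natI[of ?I m degree] Im unfolding g_def by blast
    then obtain s t where g: "g \<noteq> 0" "s \<in> polys" "t \<in> polys" "g = u * s + m * t" by blast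
    have least: "degree g \<le> degree q" if "?I q" for q
      using arg_min_nat_le[of ?I q degree] that unfolding g_def by blast
    have gP: "g \<in> polys" unfolding g(4) by (intro polys_add polys_mult g u m)
    have dvd: "\<exists>q\<in>polys. v = g * q"
      if v: "v = u * x + m * y" "x \<in> polys" "y \<in> polys" for v x y
    proof -
      have "v \<in> polys" unfolding v(1) by (intro polys_add polys_mult v u m)
      then obtain q r where qr: "q \<in> polys" "r \<in> polys" "v = g * q + r"
          "r = 0 \<or> degree r < degree g"
        using polys_division[OF gP g(1)] by blast
      have "r = u * (x - s * q) + m * (y - t * q)"
        using qr(3) v(1) g(4) by (simp add: algebra_simps)
      moreover have "x - s * q \<in> polys" "y - t * q \<in> polys"
        by (intro polys_diff polys_mult v g qr)+
      ultimately have "r = 0"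
        using least[of r] qr(4) by force
      with qr show ?thesis by auto
    qed
    obtain q1 where q1: "q1 \<in> polys" "u = g * q1"
      using dvd[of u 1 0] one polys_0 by auto
    obtain q2 where q2: "q2 \<in> polys" "m = g * q2"
      using dvd[of m 0 1] one polys_0 by auto
    have "poly g a \<noteq> 0" using False q1 by auto
    then have "poly q2 a = 0" using q2 m(3) by auto
    then obtain q3 where q3: "q3 \<in> polys" "q2 = m * q3" using m_dvd q2 by blast
    then have "m * (g * q3) = m * 1" using q2 by (simp add: mult_ac)
    then have "g * q3 = 1" using m(2) mult_left_cancel by blast
    then have "poly g a * poly q3 a = 1" by (metis poly_1 poly_mult)
    then have "poly u a * poly (s * q3) a = 1" using g(4) m(3) by (simp add: mult.assoc)
    then have "inverse (poly u a) = poly (s * q3) a" using inverse_unique by blast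
    then show ?thesis unfolding K'_def using polys_mult g q3 by blast
  qed
  have "embedded_subfield K' \<phi>'"
  proof
    have one: "1 \<in> polys" using polys_const[OF one_closed] by (simp add: one_pCons)
    show "1 \<in> K'" unfolding K'_def by (rule image_eqI[OF _ one]) simp
    show "\<phi>' 1 = 1" using \<phi>'[OF one] by (simp add: map_poly_1' hom_one)
    fix x y assume "x \<in> K'" "y \<in> K'"
    then obtain u v where u: "u \<in> polys" "x = poly u a" and v: "v \<in> polys" "y = poly v a"
      by (auto simp: K'_def)
    show "x - y \<in> K'" unfolding K'_def
      by (rule image_eqI[of _ _ "u - v"]) (use u v in \<open>auto simp: polys_diff\<close>)
    show "x * y \<in> K'" unfolding K'_def
      by (rule image_eqI[of _ _ "u * v"]) (use u v in \<open>auto simp: polys_mult\<close>)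
    show "\<phi>' (x + y) = \<phi>' x + \<phi>' y"
      using \<phi>'[OF polys_add[OF u(1) v(1)]] u v by (simp add: \<phi>' map_hom_add)
    show "\<phi>' (x * y) = \<phi>' x * \<phi>' y"
      using \<phi>'[OF polys_mult[OF u(1) v(1)]] u v by (simp add: \<phi>' map_hom_mult)
    show "inverse x \<in> K'" using inv u by simp
  qed
  moreover have "K \<subseteq> K'"
  proof
    fix c assume "c \<in> K"
    then show "c \<in> K'" unfolding K'_def
      by (intro image_eqI[of _ _ "[:c:]"]) (auto simp: polys_const)
  qed
  moreover have X: "[:0, 1:] \<in> polys"
    by (intro polys_pCons polys_0 zero_closed one_closed)
  then have "a \<in> K'" unfolding K'_def by (rule image_eqI[rotated]) simp
  moreover have "\<phi>' a = b"
    using \<phi>'[OF X] by (simp add: map_poly_pCons hom_zero hom_one)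
  moreover have "\<phi>' c = \<phi> c" if "c \<in> K" for c
    using \<phi>'[OF polys_const[OF that]] by (simp add: map_poly_pCons hom_zero)
  ultimately show ?thesis by blast
qed

end

lemma algebraic_rat_polyE:
  assumes "algebraic z"
  obtains p :: "rat poly" where "p \<noteq> 0" "poly (complex_poly p) z = 0"
  using min_poly_rat[OF assms] by (metis not_irreducible_zero)

lemma (in embedded_subfield) complex_poly_polys: "complex_poly p \<in> polys"
  by (rule polysI) (use Rats_subset in \<open>auto simp: coeff_map_poly\<close>)

lemma (in embedded_subfield) map_poly_complex_poly:
  "map_poly \<phi> (complex_poly p) = complex_poly p"
  by (rule poly_eqI) (simp add: coeff_map_poly hom_zero hom_Rats)

text \<open>
  The elements of \<open>A\<close> are adjoined one by one: the minimal polynomial of each, transported by the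
  embedding found so far, has a root because \<open>\<complex>\<close> is algebraically closed.
\<close>

lemma exists_embedding_of_finite_set:
  assumes "finite A" "\<And>z. z \<in> A \<Longrightarrow> algebraic z" "embedded_subfield K \<phi>" "x \<in> K"
  shows "\<exists>K' \<phi>'. embedded_subfield K' \<phi>' \<and> x \<in> K' \<and> A \<subseteq> K' \<and> \<phi>' x = \<phi> x"
  using assms(1,2)
proof (induction A rule: finite_induct)
  case empty
  then show ?case using assms by blast
next
  case (insert a A)
  then obtain L \<psi> where L: "embedded_subfield L \<psi>" "x \<in> L" "A \<subseteq> L" "\<psi> x = \<phi> x"
    by auto
  interpret embedded_subfield L \<psi> by (rule L)
  obtain p where p: "p \<noteq> 0" "poly (complex_poly p) a = 0"
    using insert.prems algebraic_rat_polyE by blast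
  moreover have "complex_poly p \<noteq> 0"
    using p by (simp add: map_poly_eq_0_iff)
  ultimately obtain m where m: "m \<in> polys" "m \<noteq> 0" "poly m a = 0"
    "\<And>v. v \<in> polys \<Longrightarrow> poly v a = 0 \<Longrightarrow> \<exists>q\<in>polys. v = m * q"
    using minimal_polynomial_exists[OF complex_poly_polys] by blast
  have "degree m \<noteq> 0"
  proof
    assume "degree m = 0"
    then obtain c where "m = [:c:]" by (rule degree_eq_zeroE)
    with m(2,3) show False by simp
  qed
  then have "\<not> constant (poly (map_poly \<psi> m))"
    using m(1) by (simp add: constant_degree degree_map_hom)
  then obtain b where "poly (map_poly \<psi> m) b = 0"
    using fundamental_theorem_of_algebra by blast
  from extend_to_simple_extension[OF m this] obtain L' \<psi>' where
    "embedded_subfield L' \<psi>'" "L \<subseteq> L'" "a \<in> L'" "\<forall>z\<in>L. \<psi>' z = \<psi> z" by blast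
  with L show ?case
    by (intro exI[of _ L'] exI[of _ \<psi>']) auto
qed

lemma embedded_subfield_Rats: "embedded_subfield \<rat> (\<lambda>x. x)"
  by standard auto

text \<open>
  Transitivity of the Galois group on the conjugates: \<open>x \<mapsto> y\<close> defines an embedding of \<open>\<rat>(x)\<close>, which
  extends to all conjugates. Of the resulting permutation only its effect on sums of three
  conjugates is recorded; the two directions of the equivalence come from the injectivity of field
  homomorphisms.
\<close>

theorem conjugates_automorphism:
  assumes \<alpha>: "algebraic \<alpha>" and x: "x \<in> alg_conjugates \<alpha>" and y: "y \<in> alg_conjugates \<alpha>"
  obtains \<sigma> where "bij_betw \<sigma> (alg_conjugates \<alpha>) (alg_conjugates \<alpha>)" "\<sigma> x = y"
    "\<And>u v w. u \<in> alg_conjugates \<alpha> \<Longrightarrow> v \<in> alg_conjugates \<alpha> \<Longrightarrow> w \<in> alg_conjugates \<alpha> \<Longrightarrow>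
       \<sigma> u + \<sigma> v + \<sigma> w = 0 \<longleftrightarrow> u + v + w = 0"
proof -
  define X where "X = alg_conjugates \<alpha>"
  let ?f = "min_poly_rat \<alpha>"
  note f = min_poly_rat[OF \<alpha>]
  have fnz: "?f \<noteq> 0" using f(2) by auto
  have X_iff: "z \<in> X \<longleftrightarrow> poly (complex_poly ?f) z = 0" for z
    by (simp add: X_def alg_conjugates_def)
  have X_alg: "algebraic z" if "z \<in> X" for z
    by (rule algebraicI'[of "complex_poly ?f"])
      (use that fnz in \<open>auto simp: coeff_map_poly X_iff map_poly_eq_0_iff\<close>)
  have finX: "finite X"
    unfolding X_def alg_conjugates_def using fnz by (intro poly_roots_finite) (simp add: map_poly_eq_0_iff)
  interpret Q: embedded_subfield \<rat> "\<lambda>x. x" by (rule embedded_subfield_Rats)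
  have "complex_poly ?f \<noteq> 0" using fnz by (simp add: map_poly_eq_0_iff)
  then obtain m where m: "m \<in> Q.polys" "m \<noteq> 0" "poly m x = 0"
    "\<And>v. v \<in> Q.polys \<Longrightarrow> poly v x = 0 \<Longrightarrow> \<exists>q\<in>Q.polys. v = m * q"
    using Q.minimal_polynomial_exists[OF Q.complex_poly_polys, of ?f x] x
    by (auto simp: X_iff[symmetric] X_def)
  obtain m0 where m0: "m = complex_poly m0"
    using m(1) ratpolyE unfolding Q.polys_def by blast
  have "?f dvd m0"
    using irreducible_root_dvd[OF f(2), of x m0] x m(3) by (simp add: m0 X_iff[symmetric] X_def)
  then have "poly m y = 0"
    using complex_poly_dvd_root[of ?f m0 y] y by (simp add: m0 X_iff[symmetric] X_def)
  then have "poly (map_poly (\<lambda>x. x) m) y = 0"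
    by (simp add: map_poly_idI)
  from Q.extend_to_simple_extension[OF m this] obtain K0 \<phi>0 where
    K0: "embedded_subfield K0 \<phi>0" "x \<in> K0" "\<phi>0 x = y" by blast
  from exists_embedding_of_finite_set[OF finX X_alg K0(1,2)] K0(3)
  obtain K \<phi> where K: "embedded_subfield K \<phi>" "X \<subseteq> K" "\<phi> x = y"
    by metis
  interpret embedded_subfield K \<phi> by (rule K)
  have maps: "\<phi> ` X \<subseteq> X"
  proof safe
    fix z assume z: "z \<in> X"
    then have "\<phi> (poly (complex_poly ?f) z) = poly (complex_poly ?f) (\<phi> z)"
      using hom_poly(2)[OF complex_poly_polys[of ?f]] K(2) by (auto simp: map_poly_complex_poly)
    with z show "\<phi> z \<in> X" by (simp add: X_iff hom_zero)
  qed
  have inj: "inj_on \<phi> X" using hom_inj K(2) by (rule inj_on_subset)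
  then have "bij_betw \<phi> X X"
    using maps finX by (simp add: bij_betw_def endo_inj_surj)
  moreover have "\<phi> u + \<phi> v + \<phi> w = 0 \<longleftrightarrow> u + v + w = 0" if "u \<in> X" "v \<in> X" "w \<in> X" for u v w
  proof -
    have uvw: "u \<in> K" "v \<in> K" "w \<in> K" using that K(2) by auto
    then have "\<phi> (u + v + w) = \<phi> u + \<phi> v + \<phi> w" by (simp add: hom_add add_closed)
    with uvw show ?thesis
      using hom_eq_0D[of "u + v + w"] hom_zero by (metis add_closed)
  qed
  ultimately show ?thesis using K(3) that by (simp add: X_def)
qed

section \<open>Actions of finite groups and Sylow subgroups\<close>

text \<open>
  An action given pointwise on a set has to be restricted to it, because the bijections forming
  \<^term>\<open>BijGroup E\<close> are extensional functions.
\<close>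

lemma group_actionI:
  assumes G: "group G"
    and closed: "\<And>g x. g \<in> carrier G \<Longrightarrow> x \<in> E \<Longrightarrow> act g x \<in> E"
    and one: "\<And>x. x \<in> E \<Longrightarrow> act \<one>\<^bsub>G\<^esub> x = x"
    and mult: "\<And>g h x. g \<in> carrier G \<Longrightarrow> h \<in> carrier G \<Longrightarrow> x \<in> E \<Longrightarrow>
      act (g \<otimes>\<^bsub>G\<^esub> h) x = act g (act h x)"
  shows "group_action G E (\<lambda>g. \<lambda>x\<in>E. act g x)"
proof -
  interpret group G by (rule G)
  have inv: "act g (act (inv\<^bsub>G\<^esub> g) x) = x" "act (inv\<^bsub>G\<^esub> g) (act g x) = x"
    if "g \<in> carrier G" "x \<in> E" for g x
    using that by (simp_all flip: mult add: one)
  have Bij: "(\<lambda>x\<in>E. act g x) \<in> Bij E" if "g \<in> carrier G" for g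
  proof -
    have "bij_betw (act g) E E"
      by (rule bij_betw_byWitness[where f' = "act (inv\<^bsub>G\<^esub> g)"])
        (use that in \<open>auto simp: inv closed\<close>)
    then show ?thesis by (simp add: Bij_def cong: bij_betw_cong)
  qed
  have "(\<lambda>x\<in>E. act (g \<otimes>\<^bsub>G\<^esub> h) x) = compose E (\<lambda>x\<in>E. act g x) (\<lambda>x\<in>E. act h x)"
    if "g \<in> carrier G" "h \<in> carrier G" for g h
    using that by (auto simp: compose_def mult closed fun_eq_iff)
  then have "(\<lambda>g. \<lambda>x\<in>E. act g x) \<in> hom G (BijGroup E)"
    by (intro homI) (simp_all add: BijGroup_def Bij)
  then show ?thesis
    by (simp add: group_action_def group_hom_def group_hom_axioms_def group_BijGroup G)
qed

text \<open>
  Orbit lengths divide the group order \<open>p\<^sup>a\<close>, so an orbit that is not a fixed point has length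
  divisible by \<open>p\<close>.
\<close>

lemma (in group_action) p_group_no_fixed_point:
  assumes p: "prime p" and ord: "order G = p ^ a" and fin: "finite E"
    and no_fix: "\<And>x. x \<in> E \<Longrightarrow> \<exists>g\<in>carrier G. \<phi> g x \<noteq> x"
  shows "p dvd card E"
proof -
  have "p dvd card B" if B: "B \<in> orbits G E \<phi>" for B
  proof -
    obtain x where x: "x \<in> E" "B = orbit G \<phi> x" using B by (auto simp: orbits_def)
    have "card B dvd p ^ a" using orbit_stabilizer_theorem[OF x(1)] x(2) ord by (metis dvd_triv_left)
    then obtain i where i: "card B = p ^ i" using p divides_primepow_nat by blast
    have "i \<noteq> 0"
    proof
      assume "i = 0"
      then have "card B = 1" using i by simp
      moreover have "x \<in> B" using orbit_refl x by simp
      ultimately have B1: "B = {x}" by (auto simp: card_1_singleton_iff)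
      obtain g where "g \<in> carrier G" "\<phi> g x \<noteq> x" using no_fix x by blast
      with B1 x show False by (auto simp: orbit_def)
    qed
    with i show ?thesis by simp
  qed
  then have "p dvd (\<Sum>B\<in>orbits G E \<phi>. card B)" by (rule dvd_sum)
  then show ?thesis using disjoint_sum[OF fin, of "\<lambda>_. 1 :: nat"] by simp
qed

text \<open>
  Write \<open>S\<close> for the stabilizer of \<open>x\<close> in \<open>G\<close>. The index of \<open>S \<inter> H\<close> in \<open>G\<close> is \<open>|E| \<sqdot> |S : S \<inter> H|\<close> on the
  one hand and \<open>m \<sqdot> |H x|\<close> on the other, and \<open>m\<close> is prime to \<open>p\<close>.
\<close>

lemma (in transitive_action) primepow_dvd_card_sylow_orbit:
  assumes p: "prime p" and ord: "order G = p ^ a * m" "\<not> p dvd m" and fin: "finite (carrier G)"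
    and H: "subgroup H G" "card H = p ^ a" and dvd: "p ^ k dvd card E" and x: "x \<in> E"
  shows "p ^ k dvd card (orbit (G\<lparr>carrier := H\<rparr>) \<phi> x)"
proof -
  interpret G: group G using group_hom group_hom.axioms(1) by blast
  interpret H: group_action "G\<lparr>carrier := H\<rparr>" E \<phi> by (rule induced_action[OF H(1)])
  let ?SH = "stabilizer (G\<lparr>carrier := H\<rparr>) \<phi> x" and ?S = "stabilizer G \<phi> x"
  have "orbit G \<phi> x = E"
    using x unique_orbit element_image by (fastforce simp: orbit_def)
  then have 1: "card E * card ?S = p ^ a * m"
    using orbit_stabilizer_theorem[OF x] ord by simp
  have 2: "card (orbit (G\<lparr>carrier := H\<rparr>) \<phi> x) * card ?SH = p ^ a"
    using H.orbit_stabilizer_theorem[OF x] H(2) by (simp add: order_def)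
  have "group (G\<lparr>carrier := ?S\<rparr>)"
    by (rule G.subgroup_imp_group[OF stabilizer_subgroup[OF x]])
  then interpret S: group "G\<lparr>carrier := ?S\<rparr>" .
  have sub: "?SH \<subseteq> ?S" using subgroup.subset[OF H(1)] by (auto simp: stabilizer_def)
  have "subgroup ?SH G"
    using G.incl_subgroup[OF H(1) H.stabilizer_subgroup[OF x]] .
  then have "subgroup ?SH (G\<lparr>carrier := ?S\<rparr>)"
    using G.subgroup_incl[OF _ stabilizer_subgroup[OF x] sub] by blast
  from S.lagrange[OF this] have "card ?SH dvd card ?S"
    by (intro dvdI[where k = "card (rcosets\<^bsub>G\<lparr>carrier := ?S\<rparr>\<^esub> ?SH)"]) (simp add: order_def mult.commute)
  then obtain c where c: "card ?S = card ?SH * c" by blast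
  have "card ?SH \<noteq> 0" using 2 p by (metis mult_0_right not_prime_0 power_not_zero)
  moreover have "card ?SH * (card E * c) = card ?SH * (card (orbit (G\<lparr>carrier := H\<rparr>) \<phi> x) * m)"
    using 1 2 c by (metis mult.assoc mult.commute)
  ultimately have "card E * c = card (orbit (G\<lparr>carrier := H\<rparr>) \<phi> x) * m" by simp
  with dvd have "p ^ k dvd card (orbit (G\<lparr>carrier := H\<rparr>) \<phi> x) * m"
    by (metis dvd_mult2)
  moreover have "coprime (p ^ k) m"
    using p ord(2) by (simp add: prime_imp_coprime)
  ultimately show ?thesis by (simp add: coprime_dvd_mult_left_iff)
qed

text \<open>
  Functions with residues modulo \<open>p\<close> as values are represented by their least nonnegative
  representatives. The set \<open>M\<close> is a group under addition modulo \<open>p\<close>, the multiples of a nonzero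
  element form a subgroup of order \<open>p\<close>, and Lagrange's theorem applies.
\<close>

lemma prime_dvd_card_mod_group:
  fixes M :: "('a \<Rightarrow> int) set" and p :: nat
  assumes p: "prime p" and fin: "finite M"
    and range: "\<And>f x. f \<in> M \<Longrightarrow> f x \<in> {0..<int p}"
    and lincomb: "\<And>f g c. f \<in> M \<Longrightarrow> g \<in> M \<Longrightarrow> (\<lambda>x. (f x + c * g x) mod int p) \<in> M"
    and f: "f \<in> M" "f x \<noteq> 0"
  shows "p dvd card M"
proof -
  define G where "G = \<lparr>carrier = M, mult = (\<lambda>(f :: 'a \<Rightarrow> int) g x. (f x + g x) mod int p), one = (\<lambda>_. 0 :: int)\<rparr>"
  have p0: "int p > 0" using p prime_gt_0_nat by simp
  have mod_id: "g y mod int p = g y" if "g \<in> M" for g y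
    using range[OF that] by simp
  have zero: "(\<lambda>_. 0) \<in> M" using lincomb[OF f(1) f(1), of "-1"] by simp
  have "group G"
  proof (rule groupI)
    fix g assume g: "g \<in> carrier G"
    have "(\<lambda>x. (0 + (-1) * g x) mod int p) \<in> M"
      using lincomb[OF zero, of g "-1"] g by (simp add: G_def)
    then show "\<exists>h\<in>carrier G. h \<otimes>\<^bsub>G\<^esub> g = \<one>\<^bsub>G\<^esub>"
      by (intro bexI[of _ "\<lambda>x. (0 + (-1) * g x) mod int p"]) (simp_all add: G_def mod_simps)
  next
    fix g h assume "g \<in> carrier G" "h \<in> carrier G"
    then show "g \<otimes>\<^bsub>G\<^esub> h \<in> carrier G" using lincomb[of g h 1] by (simp add: G_def)
  qed (auto simp: G_def mod_simps add.assoc zero mod_id)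
  then interpret group G .
  define H where "H = (\<lambda>k x. (int k * f x) mod int p) ` {..<p}"
  have H_mem: "(\<lambda>x. (k * f x) mod int p) \<in> H" for k
  proof -
    have "(\<lambda>x. (k * f x) mod int p) = (\<lambda>x. (int (nat (k mod int p)) * f x) mod int p)"
      using p0 by (simp add: mod_mult_left_eq)
    moreover have "nat (k mod int p) < p" using p0 by (simp add: nat_less_iff)
    ultimately show ?thesis unfolding H_def by blast
  qed
  have HM: "H \<subseteq> M"
    using lincomb[OF zero f(1)] by (auto simp: H_def)
  have "subgroup H G"
  proof (rule subgroupI)
    show "H \<subseteq> carrier G" using HM by (simp add: G_def)
    show "H \<noteq> {}" using H_mem by blast
    fix g h assume "g \<in> H" "h \<in> H"
    then obtain k l where k: "g = (\<lambda>x. (int k * f x) mod int p)" and l: "h = (\<lambda>x. (int l * f x) mod int p)"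
      by (auto simp: H_def)
    have "g \<otimes>\<^bsub>G\<^esub> h = (\<lambda>x. ((int k + int l) * f x) mod int p)"
      by (simp add: G_def k l mod_simps algebra_simps)
    then show "g \<otimes>\<^bsub>G\<^esub> h \<in> H" using H_mem by simp
    have gi: "(\<lambda>x. (- int k * f x) mod int p) \<in> H" by (rule H_mem)
    have "inv\<^bsub>G\<^esub> g = (\<lambda>x. (- int k * f x) mod int p)"
      using gi HM \<open>g \<in> H\<close> by (intro inv_equality) (auto simp: G_def k mod_simps)
    with gi show "inv\<^bsub>G\<^esub> g \<in> H" by simp
  qed
  then have "card H dvd order G" using lagrange by (metis dvd_triv_right)
  moreover have "inj_on (\<lambda>k x. (int k * f x) mod int p) {..<p}"
  proof
    fix k l assume kl: "k \<in> {..<p}" "l \<in> {..<p}"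
      and "(\<lambda>x. (int k * f x) mod int p) = (\<lambda>x. (int l * f x) mod int p)"
    then have "(int k * f x) mod int p = (int l * f x) mod int p" by meson
    then have "int p dvd (int k - int l) * f x"
      by (simp add: mod_eq_dvd_iff algebra_simps)
    moreover have "\<not> int p dvd f x"
      using range[OF f(1), of x] f(2) by (auto dest: zdvd_imp_le)
    ultimately have "int p dvd int k - int l"
      using p by (auto simp: prime_dvd_mult_iff)
    then have "int k mod int p = int l mod int p" by (simp add: mod_eq_dvd_iff)
    with kl show "k = l" by simp
  qed
  then have "card H = p" by (simp add: H_def card_image)
  ultimately show ?thesis by (simp add: order_def G_def)
qed

section \<open>Transitive triple systems with a nonzero weighting\<close>

text \<open>
  The solutions modulo \<open>p\<close> of the linear system with one equation for each block \<open>t \<in> T\<close>. Values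
  outside \<open>X\<close> are fixed to be \<open>0\<close> so that there are only finitely many solutions.
\<close>

definition weightings :: "nat \<Rightarrow> 'a set \<Rightarrow> 'a set set \<Rightarrow> ('a \<Rightarrow> int) set" where
  "weightings p X T = {f. (\<forall>x. (x \<in> X \<longrightarrow> f x \<in> {0..<int p}) \<and> (x \<notin> X \<longrightarrow> f x = 0)) \<and>
     (\<forall>t\<in>T. int p dvd sum f t)}"

lemma finite_weightings: "finite X \<Longrightarrow> finite (weightings p X T)"
  unfolding weightings_def
  by (rule finite_subset[OF _ finite_set_of_finite_funs[of X "{0..<int p}" 0]]) auto

text \<open>
  An integral solution can be divided by \<open>p\<close> as long as all its values are multiples of \<open>p\<close>; this
  decreases the sum of the absolute values, so it stops, and then reduction modulo \<open>p\<close> is nonzero.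
\<close>

lemma nonzero_weighting_exists:
  fixes n :: "'a \<Rightarrow> int"
  assumes p: "prime p" and X: "finite X" and T: "\<And>t. t \<in> T \<Longrightarrow> t \<subseteq> X"
    and n: "\<And>t. t \<in> T \<Longrightarrow> sum n t = 0" "x \<in> X" "n x \<noteq> 0"
  shows "\<exists>f\<in>weightings p X T. f \<noteq> (\<lambda>_. 0)"
  using n
proof (induction "\<Sum>x\<in>X. nat \<bar>n x\<bar>" arbitrary: n rule: less_induct)
  case less
  have p1: "int p > 1" using prime_gt_1_nat[OF p] by simp
  show ?case
  proof (cases "\<exists>y\<in>X. \<not> int p dvd n y")
    case True
    define f where "f = (\<lambda>y. if y \<in> X then n y mod int p else 0)"
    have "int p dvd sum f t" if "t \<in> T" for t
    proof -
      have "sum f t = (\<Sum>y\<in>t. n y mod int p)"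
        using T[OF that] by (intro sum.cong) (auto simp: f_def)
      then have "sum f t mod int p = sum n t mod int p" by (simp add: mod_sum_eq)
      then show ?thesis using less.prems(1)[OF that] by (simp add: dvd_eq_mod_eq_0)
    qed
    then have "f \<in> weightings p X T" using p1 by (auto simp: weightings_def f_def)
    moreover have "f \<noteq> (\<lambda>_. 0)" using True by (auto simp: f_def fun_eq_iff dvd_eq_mod_eq_0)
    ultimately show ?thesis by blast
  next
    case False
    define m where "m = (\<lambda>y. n y div int p)"
    have nm: "n y = int p * m y" if "y \<in> X" for y
      using False that by (simp add: m_def)
    have le: "nat \<bar>m y\<bar> \<le> nat \<bar>n y\<bar>" if "y \<in> X" for y
    proof -
      have "1 * \<bar>m y\<bar> \<le> int p * \<bar>m y\<bar>" using p1 by (intro mult_right_mono) auto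
      then show ?thesis using nm[OF that] by (simp add: abs_mult)
    qed
    have mx: "m x \<noteq> 0" using less.prems nm by auto
    have "1 * \<bar>m x\<bar> < int p * \<bar>m x\<bar>" using p1 mx by (intro mult_strict_right_mono) auto
    then have "nat \<bar>m x\<bar> < nat \<bar>n x\<bar>" using nm[OF less.prems(2)] by (simp add: abs_mult)
    with le have "(\<Sum>x\<in>X. nat \<bar>m x\<bar>) < (\<Sum>x\<in>X. nat \<bar>n x\<bar>)"
      using X less.prems(2) by (intro sum_strict_mono_ex1) auto
    moreover have "sum m t = 0" if "t \<in> T" for t
    proof -
      have "int p * sum m t = sum n t"
        unfolding sum_distrib_left using T[OF that] by (intro sum.cong) (auto simp: nm)
      with less.prems(1)[OF that] p1 show ?thesis by simp
    qed
    ultimately show ?thesis using less.hyps less.prems(2) mx by blast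
  qed
qed

text \<open>
  The number of all weightings is divisible by \<open>p\<close>, so the number of nonzero ones is not, and a
  \<open>p\<close>-group permuting the nonzero ones must fix one of them.
\<close>

lemma (in group_action) p_group_invariant_weighting:
  assumes p: "prime p" and ord: "order G = p ^ a" and fin: "finite E"
    and T: "\<And>t. t \<in> T \<Longrightarrow> t \<subseteq> E" "\<And>g t. g \<in> carrier G \<Longrightarrow> t \<in> T \<Longrightarrow> \<phi> g ` t \<in> T"
    and nz: "\<exists>f\<in>weightings p E T. f \<noteq> (\<lambda>_. 0)"
  shows "\<exists>f\<in>weightings p E T. f \<noteq> (\<lambda>_. 0) \<and> (\<forall>g\<in>carrier G. \<forall>x\<in>E. f (\<phi> g x) = f x)"
proof -
  interpret G: group G using group_hom group_hom.axioms(1) by blast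
  define M where "M = weightings p E T - {\<lambda>_. 0}"
  define act where "act = (\<lambda>g (f :: _ \<Rightarrow> int) x. if x \<in> E then f (\<phi> (inv g) x) else 0)"
  have p0: "int p > 0" using p prime_gt_0_nat by simp
  have closed: "\<phi> g x \<in> E" if "g \<in> carrier G" "x \<in> E" for g x
    using element_image that by blast
  have act_one: "act \<one> f = f" if "f \<in> M" for f
    using that id_eq_one[symmetric] by (auto simp: act_def M_def weightings_def fun_eq_iff)
  have act_mult: "act (g \<otimes> h) f = act g (act h f)" if "g \<in> carrier G" "h \<in> carrier G" for g h f
    using that by (auto simp: act_def fun_eq_iff G.inv_mult_group composition_rule closed)
  have act_closed: "act g f \<in> M" if g: "g \<in> carrier G" and f: "f \<in> M" for g f
  proof -
    have "int p dvd sum (act g f) t" if t: "t \<in> T" for t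
    proof -
      have "inj_on (\<phi> (inv g)) t"
        using inj_prop[of "inv g"] g T(1)[OF t] by (auto intro: inj_on_subset)
      then have "sum (act g f) t = sum f (\<phi> (inv g) ` t)"
        using T(1)[OF t] by (auto simp: sum.reindex act_def intro!: sum.cong)
      then show ?thesis using f T(2)[of "inv g" t] g t by (auto simp: M_def weightings_def)
    qed
    then have "act g f \<in> weightings p E T"
      using f g by (auto simp: M_def weightings_def act_def closed)
    moreover have "act g f \<noteq> (\<lambda>_. 0)"
    proof
      assume "act g f = (\<lambda>_. 0)"
      then have "act (inv g \<otimes> g) f = act (inv g) (\<lambda>_. 0)"
        using act_mult[of "inv g" g f] g by simp
      then have "f = (\<lambda>_. 0)" using g f act_one by (simp add: act_def)
      with f show False by (simp add: M_def)
    qed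
    ultimately show ?thesis by (simp add: M_def)
  qed
  interpret A: group_action G M "\<lambda>g. \<lambda>f\<in>M. act g f"
    by (rule group_actionI) (auto simp: act_closed act_one act_mult)
  have zero: "(\<lambda>_. 0) \<in> weightings p E T" using p0 by (simp add: weightings_def)
  obtain f0 x0 where f0: "f0 \<in> weightings p E T" "f0 x0 \<noteq> 0"
    using nz by (auto simp: fun_eq_iff)
  have finW: "finite (weightings p E T)" by (rule finite_weightings[OF fin])
  have "p dvd card (weightings p E T)"
  proof (rule prime_dvd_card_mod_group[OF p finW _ _ f0])
    fix f g :: "_ \<Rightarrow> int" and c x
    assume f: "f \<in> weightings p E T"
    then show "f x \<in> {0..<int p}" using p0 by (cases "x \<in> E") (auto simp: weightings_def)
    assume g: "g \<in> weightings p E T"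
    have "int p dvd (\<Sum>x\<in>t. (f x + c * g x) mod int p)" if t: "t \<in> T" for t
    proof -
      have "int p dvd sum f t + c * sum g t"
        using f g t by (auto simp: weightings_def)
      then have "int p dvd (\<Sum>x\<in>t. f x + c * g x)"
        by (simp add: sum.distrib sum_distrib_left)
      then show ?thesis by (simp add: dvd_eq_mod_eq_0 mod_sum_eq)
    qed
    then show "(\<lambda>x. (f x + c * g x) mod int p) \<in> weightings p E T"
      using f g p0 by (auto simp: weightings_def)
  qed
  moreover have "card (weightings p E T) = Suc (card M)"
    unfolding M_def using finW zero by (metis card.remove)
  ultimately have "\<not> p dvd card M"
    using p by (metis One_nat_def dvd_1_iff_1 dvd_add_right_iff not_prime_1 plus_1_eq_Suc add.commute)
  then obtain f where f: "f \<in> M" "\<And>g. g \<in> carrier G \<Longrightarrow> act g f = f"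
    using A.p_group_no_fixed_point[OF p ord] finW by (auto simp: M_def)
  have "f (\<phi> g x) = f x" if "g \<in> carrier G" "x \<in> E" for g x
    using fun_cong[OF f(2)[of "inv g"], of x] that by (simp add: act_def)
  with f(1) show ?thesis by (auto simp: M_def)
qed

text \<open>
  A Sylow \<open>p\<close>-subgroup \<open>H\<close> has a nonzero invariant weighting \<open>f\<close> modulo \<open>p\<close>, which is constant on the
  orbits of \<open>H\<close>. It is not constant on \<open>E\<close>, because the sum over a block would then be three times a
  nonzero value, while \<open>p \<noteq> 3\<close>. This excludes \<open>p\<^sup>k\<close> points, for which \<open>H\<close> is transitive.

  For \<open>2 p\<^sup>k\<close> points there are two orbits \<open>A\<close> and \<open>B\<close> of length \<open>p\<^sup>k\<close>, with values \<open>u \<noteq> v\<close> of \<open>f\<close>. If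
  \<open>j\<close> points of a block lie in \<open>A\<close>, then \<open>j (u - v) + 3 v\<close> is \<open>0\<close> modulo \<open>p\<close>, which determines
  \<open>j \<in> {0,...,3}\<close> because \<open>p > 3\<close>: it is the same for all blocks. By transitivity of \<open>G\<close> all points
  lie in equally many blocks, so counting incidences gives \<open>|T| j\<close> for \<open>A\<close> and \<open>|T| (3 - j)\<close> for \<open>B\<close>,
  and these agree since \<open>|A| = |B|\<close>. But \<open>2 j = 3\<close> is impossible.
\<close>

theorem (in transitive_action) triple_system_degree:
  fixes n :: "_ \<Rightarrow> int"
  assumes G: "finite (carrier G)" and E: "finite E"
    and T: "\<And>t. t \<in> T \<Longrightarrow> t \<subseteq> E \<and> card t = 3" "\<And>g t. g \<in> carrier G \<Longrightarrow> t \<in> T \<Longrightarrow> \<phi> g ` t \<in> T"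
      "T \<noteq> {}"
    and n: "\<And>t. t \<in> T \<Longrightarrow> sum n t = 0" "x0 \<in> E" "n x0 \<noteq> 0"
    and p: "prime p" "p \<noteq> 3"
  shows "card E \<noteq> p ^ k" and "p > 3 \<Longrightarrow> card E \<noteq> 2 * p ^ k"
proof -
  interpret G: group G using group_hom group_hom.axioms(1) by blast
  define a where "a = multiplicity p (order G)"
  define m where "m = order G div p ^ a"
  have "order G > 0" using G G.order_gt_0_iff_finite by blast
  moreover have "\<not> is_unit p" using p(1) not_prime_unit by blast
  ultimately have ord: "order G = p ^ a * m" "\<not> p dvd m"
    unfolding a_def m_def by (simp_all add: multiplicity_dvd multiplicity_decompose)
  obtain H where H: "subgroup H G" "card H = p ^ a"
    using sylow_thm[OF p(1) G.group_axioms ord(1) G] by blast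
  interpret H: group_action "G\<lparr>carrier := H\<rparr>" E \<phi> by (rule induced_action[OF H(1)])
  have H_sub: "H \<subseteq> carrier G" by (rule subgroup.subset[OF H(1)])
  let ?orb = "orbit (G\<lparr>carrier := H\<rparr>) \<phi>"
  have T_E: "\<And>t. t \<in> T \<Longrightarrow> t \<subseteq> E" using T(1) by blast
  obtain f where f: "f \<in> weightings p E T" "f \<noteq> (\<lambda>_. 0)" "\<And>g x. g \<in> H \<Longrightarrow> x \<in> E \<Longrightarrow> f (\<phi> g x) = f x"
  proof -
    have ord_H: "order (G\<lparr>carrier := H\<rparr>) = p ^ a" using H(2) by (simp add: order_def)
    have "\<exists>f\<in>weightings p E T. f \<noteq> (\<lambda>_. 0) \<and>
        (\<forall>g\<in>carrier (G\<lparr>carrier := H\<rparr>). \<forall>x\<in>E. f (\<phi> g x) = f x)"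
      by (rule H.p_group_invariant_weighting[OF p(1) ord_H E _ _ nonzero_weighting_exists[OF p(1) E T_E n]])
        (use T_E T(2) H_sub in auto)
    then show thesis using that by auto
  qed
  have f_range: "f x \<in> {0..<int p}" if "x \<in> E" for x
    using f(1) that by (simp add: weightings_def)
  have f_sum: "int p dvd sum f t" if "t \<in> T" for t
    using f(1) that by (simp add: weightings_def)
  have f_orb: "f z = f x" if "x \<in> E" "z \<in> ?orb x" for x z
    using that f(3) by (auto simp: orbit_def)
  have orb_sub: "?orb x \<subseteq> E" if "x \<in> E" for x
    using that H.element_image by (auto simp: orbit_def)
  have orb_dvd: "p ^ k dvd card (?orb x)" if "p ^ k dvd card E" "x \<in> E" for k x
    using primepow_dvd_card_sylow_orbit[OF p(1) ord G H] that by blast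
  have orb_fin: "finite (?orb x)" if "x \<in> E" for x
    using orb_sub[OF that] E finite_subset by blast
  have orb_pos: "card (?orb x) > 0" if "x \<in> E" for x
    using orb_fin[OF that] H.orbit_refl[OF that] by (auto simp: card_gt_0_iff)
  have T_fin: "finite T" using T_E E by (meson Pow_iff finite_Pow_iff finite_subset subsetI)
  have t_fin: "finite t" if "t \<in> T" for t using T(1)[OF that] E finite_subset by blast
  have p3: "\<not> int p dvd 3"
  proof
    assume "int p dvd 3"
    then have "p dvd 3" by presburger
    with p show False using primes_dvd_imp_eq[of p 3] by (simp add: prime_nat_numeral_eq)
  qed
  have not_const: False if "\<And>x. x \<in> E \<Longrightarrow> f x = c" for c
  proof -
    obtain t where t: "t \<in> T" using T(3) by blast
    have "sum f t = 3 * c"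
      using T(1)[OF t] that by (subst sum.cong[of t t f "\<lambda>_. c"]) auto
    then have "int p dvd 3 * c" using f_sum[OF t] by simp
    then have "int p dvd c" using p3 p(1) by (simp add: prime_dvd_mult_iff)
    moreover have "c \<in> {0..<int p}" using f_range[OF n(2)] that[OF n(2)] by simp
    ultimately have "c = 0" by (auto dest: zdvd_imp_le)
    moreover have "f x = 0" if "x \<notin> E" for x using f(1) that by (simp add: weightings_def)
    ultimately have "f = (\<lambda>_. 0)" using that by (metis ext)
    with f(2) show False by simp
  qed
  show "card E \<noteq> p ^ k"
  proof
    assume k: "card E = p ^ k"
    have "card E \<le> card (?orb x0)"
      using orb_dvd[of k x0] orb_pos[OF n(2)] n(2) k by (auto intro: dvd_imp_le)
    then have "?orb x0 = E" using card_seteq[OF E orb_sub[OF n(2)]] by simp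
    then show False using not_const[of "f x0"] f_orb n(2) by blast
  qed
  show "card E \<noteq> 2 * p ^ k" if "p > 3"
  proof
    assume k: "card E = 2 * p ^ k"
    have orb_card: "card (?orb x) = p ^ k" if x: "x \<in> E" for x
    proof -
      have 1: "p ^ k dvd card (?orb x)" using orb_dvd[of k x] x k by simp
      have "card (?orb x) dvd order (G\<lparr>carrier := H\<rparr>)"
        by (rule dvdI[OF H.orbit_stabilizer_theorem[OF x, symmetric]])
      then have "card (?orb x) dvd p ^ a" using H(2) by (simp add: order_def)
      then obtain i where i: "card (?orb x) = p ^ i" using p divides_primepow_nat by blast
      have "card (?orb x) \<le> 2 * p ^ k" using card_mono[OF E orb_sub[OF x]] k by simp
      also have "\<dots> < p ^ Suc k" using \<open>p > 3\<close> by simp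
      finally have "p ^ i < p ^ Suc k" unfolding i .
      then have "i < Suc k"
        by (rule power_less_imp_less_exp[rotated]) (use \<open>p > 3\<close> in simp)
      moreover have "k \<le> i" using 1 i \<open>p > 3\<close> by (simp add: dvd_power_iff_le)
      ultimately show ?thesis using i by (simp add: le_antisym less_Suc_eq_le)
    qed
    have "?orb x0 \<noteq> E" using orb_card[OF n(2)] k \<open>p > 3\<close> by auto
    then obtain y0 where y0: "y0 \<in> E" "y0 \<notin> ?orb x0" using orb_sub[OF n(2)] by blast
    let ?A = "?orb x0" and ?B = "?orb y0"
    have disj: "?A \<inter> ?B = {}"
    proof (rule ccontr)
      assume "?A \<inter> ?B \<noteq> {}"
      moreover have "?A \<in> orbits (G\<lparr>carrier := H\<rparr>) E \<phi>" "?B \<in> orbits (G\<lparr>carrier := H\<rparr>) E \<phi>"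
        using n(2) y0(1) by (auto simp: orbits_def)
      ultimately have "?A = ?B" using H.disjoint_union by blast
      with y0 H.orbit_refl[OF y0(1)] show False by simp
    qed
    have AB: "?A \<union> ?B = E"
    proof (rule card_seteq[OF E])
      show "?A \<union> ?B \<subseteq> E" using orb_sub n(2) y0(1) by blast
      show "card E \<le> card (?A \<union> ?B)"
        using card_Un_disjoint[OF orb_fin[OF n(2)] orb_fin[OF y0(1)] disj] orb_card n(2) y0(1) k by simp
    qed
    define u v where "u = f x0" and "v = f y0"
    have fA: "f x = u" if "x \<in> ?A" for x using f_orb[OF n(2) that] by (simp add: u_def)
    have fB: "f x = v" if "x \<in> ?B" for x using f_orb[OF y0(1) that] by (simp add: v_def)
    have uv: "u \<noteq> v" using not_const[of u] fA fB AB by blast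
    have tAB: "card (t \<inter> ?A) + card (t \<inter> ?B) = 3" if t: "t \<in> T" for t
    proof -
      have "t = (t \<inter> ?A) \<union> (t \<inter> ?B)" using AB T(1)[OF t] by blast
      then have "card t = card (t \<inter> ?A) + card (t \<inter> ?B)"
        using t_fin[OF t] disj card_Un_disjoint[of "t \<inter> ?A" "t \<inter> ?B"] by auto
      then show ?thesis using T(1)[OF t] by simp
    qed
    have tsum: "int p dvd int (card (t \<inter> ?A)) * (u - v) + 3 * v" if t: "t \<in> T" for t
    proof -
      have "sum f t = sum f ((t \<inter> ?A) \<union> (t \<inter> ?B))"
        using AB T(1)[OF t] by (intro arg_cong[of _ _ "sum f"]) blast
      also have "\<dots> = sum f (t \<inter> ?A) + sum f (t \<inter> ?B)"
        using t_fin[OF t] disj by (intro sum.union_disjoint) auto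
      also have "sum f (t \<inter> ?A) = int (card (t \<inter> ?A)) * u"
        by (subst sum.cong[of _ _ _ "\<lambda>_. u"]) (auto simp: fA)
      also have "sum f (t \<inter> ?B) = int (card (t \<inter> ?B)) * v"
        by (subst sum.cong[of _ _ _ "\<lambda>_. v"]) (auto simp: fB)
      also have "int (card (t \<inter> ?B)) = 3 - int (card (t \<inter> ?A))" using tAB[OF t] by linarith
      finally have "sum f t = int (card (t \<inter> ?A)) * (u - v) + 3 * v" by (simp add: algebra_simps)
      with f_sum[OF t] show ?thesis by simp
    qed
    have same: "card (t \<inter> ?A) = card (t' \<inter> ?A)" if t: "t \<in> T" "t' \<in> T" for t t'
    proof -
      have "int p dvd (int (card (t \<inter> ?A)) - int (card (t' \<inter> ?A))) * (u - v)"
        using dvd_diff[OF tsum[OF t(1)] tsum[OF t(2)]] by (simp add: algebra_simps)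
      moreover have "\<not> int p dvd u - v"
      proof
        assume "int p dvd u - v"
        then have "u mod int p = v mod int p" by (simp add: mod_eq_dvd_iff)
        with uv f_range[OF n(2)] f_range[OF y0(1)] show False by (simp add: u_def v_def)
      qed
      ultimately have "int p dvd int (card (t \<inter> ?A)) - int (card (t' \<inter> ?A))"
        using p(1) by (auto simp: prime_dvd_mult_iff)
      then have "card (t \<inter> ?A) mod p = card (t' \<inter> ?A) mod p"
        by (simp only: mod_eq_dvd_iff[symmetric] of_nat_mod[symmetric] of_nat_eq_iff)
      moreover have "card (t \<inter> ?A) < p" "card (t' \<inter> ?A) < p"
        using tAB[OF t(1)] tAB[OF t(2)] \<open>p > 3\<close> by linarith+
      ultimately show ?thesis by simp
    qed
    have r: "card {t\<in>T. x \<in> t} = card {t\<in>T. x0 \<in> t}" if x: "x \<in> E" for x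
    proof -
      have le: "card {t\<in>T. x \<in> t} \<le> card {t\<in>T. y \<in> t}" if xy: "x \<in> E" "y \<in> E" for x y
      proof -
        obtain g where g: "g \<in> carrier G" "\<phi> g x = y" using unique_orbit xy by blast
        show ?thesis
        proof (rule card_inj_on_le[of "\<lambda>t. \<phi> g ` t"])
          show "inj_on (\<lambda>t. \<phi> g ` t) {t \<in> T. x \<in> t}"
            by (rule inj_on_subset[OF inj_on_image_Pow[OF inj_prop[OF g(1)]]]) (use T_E in auto)
          show "(\<lambda>t. \<phi> g ` t) ` {t \<in> T. x \<in> t} \<subseteq> {t \<in> T. y \<in> t}"
            using T(2)[OF g(1)] g(2) by auto
        qed (use T_fin in simp)
      qed
      show ?thesis using le[OF x n(2)] le[OF n(2) x] by simp
    qed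
    have count: "(\<Sum>t\<in>T. card (t \<inter> S)) = card S * card {t\<in>T. x0 \<in> t}" if S: "S \<subseteq> E" for S
    proof -
      have finS: "finite S" using S E finite_subset by blast
      have "(\<Sum>t\<in>T. card (t \<inter> S)) = (\<Sum>t\<in>T. \<Sum>x\<in>S. if x \<in> t then 1 else 0)"
        using finS by (intro sum.cong) (auto simp: sum.If_cases Int_commute)
      also have "\<dots> = (\<Sum>x\<in>S. \<Sum>t\<in>T. if x \<in> t then 1 else 0)" by (rule sum.swap)
      also have "\<dots> = (\<Sum>x\<in>S. card {t\<in>T. x0 \<in> t})"
        using T_fin r S by (intro sum.cong) (auto simp: sum.If_cases Int_def)
      finally show ?thesis by simp
    qed
    obtain t0 where t0: "t0 \<in> T" using T(3) by blast
    have "(\<Sum>t\<in>T. card (t \<inter> ?A)) = (\<Sum>t\<in>T. card (t \<inter> ?B))"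
      using count[OF orb_sub[OF n(2)]] count[OF orb_sub[OF y0(1)]] orb_card n(2) y0(1) by simp
    moreover have "(\<Sum>t\<in>T. card (t \<inter> ?A)) = card T * card (t0 \<inter> ?A)"
      using same[OF _ t0] by simp
    moreover have "card (t \<inter> ?B) = card (t0 \<inter> ?B)" if "t \<in> T" for t
      using same[OF that t0] tAB[OF that] tAB[OF t0] by linarith
    then have "(\<Sum>t\<in>T. card (t \<inter> ?B)) = card T * card (t0 \<inter> ?B)" by simp
    moreover have "card T > 0" using T_fin T(3) by (simp add: card_gt_0_iff)
    ultimately have "card (t0 \<inter> ?A) = card (t0 \<inter> ?B)" by simp
    with tAB[OF t0] have "2 * card (t0 \<inter> ?A) = 3" by simp
    then show False by arith
  qed
qed

section \<open>Integral solutions\<close>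

lemma common_denominator:
  fixes l :: "'a \<Rightarrow> rat"
  assumes "finite X"
  shows "\<exists>D::int. D > 0 \<and> (\<forall>x\<in>X. of_int D * l x \<in> \<int>)"
  using assms
proof (induction X rule: finite_induct)
  case empty
  show ?case by (intro exI[of _ 1]) simp
next
  case (insert y X)
  then obtain D where D: "D > 0" "\<forall>x\<in>X. of_int D * l x \<in> \<int>" by blast
  obtain a b where ab: "b > 0" "l y = of_int a / of_int b"
    by (metis quotient_of_denom_pos quotient_of_div surj_pair)
  have "of_int (D * b) * l x \<in> \<int>" if "x \<in> insert y X" for x
  proof (cases "x = y")
    case True
    then show ?thesis using ab by simp
  next
    case False
    then have "of_int D * l x \<in> \<int>" using D that by blast
    from Ints_mult[OF Ints_of_int this] have "of_int b * (of_int D * l x) \<in> \<int>" .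
    then show ?thesis by (simp add: mult_ac)
  qed
  moreover have "D * b > 0" using D ab by simp
  ultimately show ?case by blast
qed

text \<open>
  The inclusion of \<open>X\<close> into \<open>\<complex>\<close> solves the system. Composing it with a \<open>\<rat>\<close>-linear functional that
  does not vanish at \<open>x\<close> gives a rational solution.
\<close>

lemma integral_solution_exists:
  fixes X :: "complex set"
  assumes X: "finite X" and T: "\<And>t. t \<in> T \<Longrightarrow> t \<subseteq> X \<and> \<Sum>t = 0" and x: "x \<in> X" "x \<noteq> 0"
  shows "\<exists>n :: complex \<Rightarrow> int. (\<forall>t\<in>T. sum n t = 0) \<and> n x \<noteq> 0"
proof -
  interpret vector_space_pair "\<lambda>(q :: rat) (z :: complex). of_rat q * z" "(*) :: rat \<Rightarrow> rat \<Rightarrow> rat"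
    by unfold_locales (simp_all add: algebra_simps of_rat_add of_rat_mult)
  have "vs1.independent {x}" using x by (simp add: vs1.dependent_single)
  then obtain l where l: "Vector_Spaces.linear (\<lambda>(q :: rat) (z :: complex). of_rat q * z) (*) l" "l x = 1"
    using linear_independent_extend[of "{x}" "\<lambda>_. 1"] by auto
  have l_sum: "l (sum g t) = (\<Sum>z\<in>t. l (g z))" for g and t :: "complex set"
    using linear_sum[OF l(1)] .
  obtain D where D: "D > 0" "\<And>x. x \<in> X \<Longrightarrow> of_int D * l x \<in> \<int>"
    using common_denominator[OF X, of l] by blast
  define n where "n = (\<lambda>z. \<lfloor>of_int D * l z\<rfloor>)"
  have n: "of_int (n z) = of_int D * l z" if "z \<in> X" for z
    using D(2)[OF that] by (simp add: n_def)
  have "sum n t = 0" if t: "t \<in> T" for t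
  proof -
    have "(of_int (sum n t) :: rat) = (\<Sum>z\<in>t. of_int D * l z)"
      using T[OF t] n by (auto intro!: sum.cong)
    also have "\<dots> = of_int D * l (\<Sum>t)" by (simp add: l_sum sum_distrib_left)
    also have "\<dots> = 0" using T[OF t] linear_0[OF l(1)] by simp
    finally show ?thesis by (simp only: of_int_eq_0_iff)
  qed
  moreover have "n x \<noteq> 0" using n[OF x(1)] l(2) D(1) by auto
  ultimately show ?thesis by blast
qed

section \<open>Forbidden degrees\<close>

text \<open>
  That \<open>\<sigma>\<close> preserves \<open>T\<close> is demanded in both directions so that inverses preserve it as well.
\<close>

lemma automorphism_group_action:
  fixes X :: "'a set" and T :: "'a set set"
  defines "A \<equiv> {\<sigma> \<in> Bij X. \<forall>t. t \<subseteq> X \<longrightarrow> (\<sigma> ` t \<in> T \<longleftrightarrow> t \<in> T)}"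
  shows "group_action (BijGroup X\<lparr>carrier := A\<rparr>) X (\<lambda>\<sigma>. \<sigma>)"
proof -
  interpret B: group "BijGroup X" by (rule group_BijGroup)
  have BX: "bij_betw \<sigma> X X" if "\<sigma> \<in> Bij X" for \<sigma> using that by (simp add: Bij_def)
  have act: "group_action (BijGroup X) X (\<lambda>\<sigma>. \<sigma>)"
    by (simp add: group_action_def group_hom_def group_hom_axioms_def B.group_axioms hom_def)
  have "subgroup A (BijGroup X)"
  proof (rule B.subgroupI)
    show "A \<subseteq> carrier (BijGroup X)" by (auto simp: A_def BijGroup_def)
    have "(\<lambda>x\<in>X. x) ` t = t" if "t \<subseteq> X" for t using that by force
    then have "(\<lambda>x\<in>X. x) \<in> A" by (auto simp: A_def id_Bij)
    then show "A \<noteq> {}" by blast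
    fix \<sigma> assume \<sigma>: "\<sigma> \<in> A"
    then have \<sigma>B: "\<sigma> \<in> Bij X" by (simp add: A_def)
    have "(\<lambda>x\<in>X. inv_into X \<sigma> x) ` t \<in> T \<longleftrightarrow> t \<in> T" if t: "t \<subseteq> X" for t
    proof -
      define s where "s = (\<lambda>x\<in>X. inv_into X \<sigma> x) ` t"
      have "s = inv_into X \<sigma> ` t" unfolding s_def using t by (intro image_cong) auto
      then have "s \<subseteq> X" "\<sigma> ` s = t"
        using t BX[OF \<sigma>B] by (auto simp: bij_betw_def inv_into_into image_inv_into_cancel)
      with \<sigma> show ?thesis unfolding s_def[symmetric] A_def by auto
    qed
    then show "inv\<^bsub>BijGroup X\<^esub> \<sigma> \<in> A"
      using \<sigma>B by (simp add: inv_BijGroup A_def restrict_inv_into_Bij)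
    fix \<tau> assume \<tau>: "\<tau> \<in> A"
    then have \<tau>B: "\<tau> \<in> Bij X" by (simp add: A_def)
    have "compose X \<sigma> \<tau> ` t \<in> T \<longleftrightarrow> t \<in> T" if t: "t \<subseteq> X" for t
    proof -
      have "compose X \<sigma> \<tau> ` t = \<sigma> ` \<tau> ` t" using t by (auto simp: compose_def image_def subset_iff)
      moreover have "\<tau> ` t \<subseteq> X" using t BX[OF \<tau>B] by (auto simp: bij_betw_def)
      ultimately show ?thesis using \<sigma> \<tau> t by (auto simp: A_def)
    qed
    then show "\<sigma> \<otimes>\<^bsub>BijGroup X\<^esub> \<tau> \<in> A"
      using \<sigma>B \<tau>B by (simp add: BijGroup_def A_def compose_Bij)
  qed
  then show ?thesis by (rule group_action.induced_action[OF act])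
qed

text \<open>
  The conjugates with their zero-sum triples form a triple system on which, by Galois theory, the
  automorphism group is transitive.
\<close>

theorem degree_restriction:
  assumes \<alpha>: "algebraic \<alpha>" and three: "three_conjugates_sum_zero \<alpha>" and p: "prime p" "p \<noteq> 3"
  shows "alg_degree \<alpha> \<noteq> p ^ k" and "p > 3 \<Longrightarrow> alg_degree \<alpha> \<noteq> 2 * p ^ k"
proof -
  define X where "X = alg_conjugates \<alpha>"
  define T where "T = {t. t \<subseteq> X \<and> card t = 3 \<and> \<Sum>t = 0}"
  define A where "A = {\<sigma> \<in> Bij X. \<forall>t. t \<subseteq> X \<longrightarrow> (\<sigma> ` t \<in> T \<longleftrightarrow> t \<in> T)}"
  define G where "G = BijGroup X\<lparr>carrier := A\<rparr>"
  obtain x y z where xyz: "x \<in> X" "y \<in> X" "z \<in> X" "x \<noteq> y" "x \<noteq> z" "y \<noteq> z" "x + y + z = 0"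
    using three by (auto simp: three_conjugates_sum_zero_def X_def)
  have card_X: "card X = alg_degree \<alpha>" unfolding X_def by (rule card_alg_conjugates[OF \<alpha>])
  have "min_poly_rat \<alpha> \<noteq> 0" using min_poly_rat(2)[OF \<alpha>] by auto
  then have X: "finite X"
    unfolding X_def alg_conjugates_def by (intro poly_roots_finite) (simp add: map_poly_eq_0_iff)
  have "{x, y, z} \<in> T" using xyz by (simp add: T_def add.assoc)
  then have T_ne: "T \<noteq> {}" by blast
  obtain x0 where x0: "x0 \<in> X" "x0 \<noteq> 0" using xyz by metis
  obtain n :: "complex \<Rightarrow> int" where n: "\<forall>t\<in>T. sum n t = 0" "n x0 \<noteq> 0"
    using integral_solution_exists[OF X _ x0, of T] by (auto simp: T_def)
  interpret group_action G X "\<lambda>\<sigma>. \<sigma>"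
    unfolding G_def A_def by (rule automorphism_group_action)
  interpret transitive_action G X "\<lambda>\<sigma>. \<sigma>"
  proof
    fix x y assume "x \<in> X" "y \<in> X"
    then obtain \<sigma> where \<sigma>: "bij_betw \<sigma> X X" "\<sigma> x = y"
      "\<And>u v w. u \<in> X \<Longrightarrow> v \<in> X \<Longrightarrow> w \<in> X \<Longrightarrow> \<sigma> u + \<sigma> v + \<sigma> w = 0 \<longleftrightarrow> u + v + w = 0"
      using conjugates_automorphism[OF \<alpha>] unfolding X_def by metis
    have "restrict \<sigma> X ` t \<in> T \<longleftrightarrow> t \<in> T" if t: "t \<subseteq> X" for t
    proof -
      have im: "restrict \<sigma> X ` t = \<sigma> ` t" using t by (auto simp: image_def subset_iff)
      have inj: "inj_on \<sigma> t" using \<sigma>(1) t by (auto simp: bij_betw_def intro: inj_on_subset)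
      have "\<sigma> ` t \<subseteq> X" using \<sigma>(1) t by (auto simp: bij_betw_def)
      moreover have "card (\<sigma> ` t) = card t" using inj by (rule card_image)
      moreover have "\<Sum>(\<sigma> ` t) = 0 \<longleftrightarrow> \<Sum>t = 0" if "card t = 3"
      proof -
        obtain u v w where uvw: "t = {u, v, w}" "u \<noteq> v" "u \<noteq> w" "v \<noteq> w"
          using \<open>card t = 3\<close> by (auto simp: card_3_iff)
        have "\<Sum>(\<sigma> ` t) = (\<Sum>i\<in>t. \<sigma> i)" using inj by (simp add: sum.reindex)
        then show ?thesis using uvw t \<sigma>(3)[of u v w] by (simp add: add.assoc)
      qed
      ultimately show ?thesis unfolding im using t by (auto simp: T_def)
    qed
    then have "restrict \<sigma> X \<in> carrier G"
      using \<sigma>(1) by (simp add: G_def A_def Bij_def cong: bij_betw_cong)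
    then show "\<exists>g\<in>carrier G. g x = y" using \<sigma>(2) \<open>x \<in> X\<close> by (intro bexI[of _ "restrict \<sigma> X"]) auto
  qed
  have "carrier G \<subseteq> X \<rightarrow>\<^sub>E X"
    by (auto simp: G_def A_def Bij_def bij_betw_def PiE_def)
  then have fin: "finite (carrier G)" using X by (meson finite_PiE finite_subset)
  have T_inv: "g ` t \<in> T" if "g \<in> carrier G" "t \<in> T" for g t
    using that by (auto simp: G_def A_def T_def)
  have T3: "t \<subseteq> X \<and> card t = 3" if "t \<in> T" for t using that by (simp add: T_def)
  have n0: "sum n t = 0" if "t \<in> T" for t using n(1) that by blast
  note degree = triple_system_degree[OF fin X T3 T_inv T_ne n0 x0(1) n(2) p, unfolded card_X]
  show "alg_degree \<alpha> \<noteq> p ^ k" by (rule degree(1))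
  show "alg_degree \<alpha> \<noteq> 2 * p ^ k" if "p > 3" by (rule degree(2)[OF _ _ _ _ that])
qed

lemma small_degree_cases:
  fixes d :: nat
  assumes "0 < d" "\<not> 3 dvd d" "d < 20"
  shows "\<exists>p k. prime p \<and> p \<noteq> 3 \<and> (d = p ^ k \<or> p > 3 \<and> d = 2 * p ^ k)"
proof -
  have prime_power: ?thesis if "d = p ^ k" "prime p" "p \<noteq> 3" for p k using that by blast
  have twice: ?thesis if "d = 2 * p ^ k" "prime p" "p > 3" for p k using that by blast
  have "\<forall>d\<in>{0..<20::nat}. 0 < d \<longrightarrow> \<not> 3 dvd d \<longrightarrow>
      d \<in> {1, 2, 4, 5, 7, 8, 10, 11, 13, 14, 16, 17, 19}"
    by code_simp
  then have "d \<in> {1, 2, 4, 5, 7, 8, 10, 11, 13, 14, 16, 17, 19}"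
    using assms by simp
  then consider "d = 2 ^ 0" | "d = 2 ^ 1" | "d = 2 ^ 2" | "d = 2 ^ 3" | "d = 2 ^ 4" |
    "d = 5 ^ 1" | "d = 7 ^ 1" | "d = 11 ^ 1" | "d = 13 ^ 1" | "d = 17 ^ 1" | "d = 19 ^ 1" |
    "d = 2 * 5 ^ 1" | "d = 2 * 7 ^ 1"
    by auto
  then show ?thesis
    by cases ((erule prime_power | erule twice); simp)+
qed

section \<open>An algebraic number of degree 20\<close>

text \<open>
  Since \<open>p\<^sup>2\<close> does not divide the constant coefficient of the product, one factor, say \<open>B\<close>, has a
  constant coefficient prime to \<open>p\<close>. If \<open>B\<close> is not constant, then \<open>A\<close> has smaller degree than the
  product, whose coefficients up to that degree are divisible by \<open>p\<close>; inductively so are all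
  coefficients of \<open>A\<close>, the leading one included, contradicting that the product is monic.
\<close>

lemma eisenstein_int:
  fixes F A B :: "int poly" and p :: nat
  assumes p: "prime p" and F: "lead_coeff F = 1" "\<And>i. i < degree F \<Longrightarrow> int p dvd coeff F i"
    "\<not> (int p)\<^sup>2 dvd coeff F 0"
    and AB: "F = A * B"
  shows "degree A = 0 \<or> degree B = 0"
proof -
  have p': "prime (int p)" using p by simp
  have nz: "F \<noteq> 0" "A \<noteq> 0" "B \<noteq> 0" using F(1) AB by auto
  have deg: "degree F = degree A + degree B" using AB nz by (simp add: degree_mult_eq)
  have main: "degree B = 0"
    if AB: "F = A * B" and nz: "A \<noteq> 0" "B \<noteq> 0" and B0: "\<not> int p dvd coeff B 0" for A B
  proof (rule ccontr)
    assume "degree B \<noteq> 0"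
    then have deg: "degree A < degree F" using AB nz by (simp add: degree_mult_eq)
    have "int p dvd coeff A i" if "i \<le> degree A" for i
      using that
    proof (induction i rule: less_induct)
      case (less i)
      have "coeff F i = (\<Sum>j\<le>i. coeff A j * coeff B (i - j))" by (simp add: AB coeff_mult)
      also have "\<dots> = (\<Sum>j<i. coeff A j * coeff B (i - j)) + coeff A i * coeff B 0"
        by (simp flip: lessThan_Suc_atMost)
      finally have eq: "coeff A i * coeff B 0 = coeff F i - (\<Sum>j<i. coeff A j * coeff B (i - j))"
        by simp
      have "int p dvd (\<Sum>j<i. coeff A j * coeff B (i - j))"
        using less by (intro dvd_sum dvd_mult2) auto
      moreover have "int p dvd coeff F i" using F(2) less.prems deg by simp
      ultimately have "int p dvd coeff A i * coeff B 0" unfolding eq by (rule dvd_diff[rotated])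
      with B0 p' show ?case by (simp add: prime_dvd_mult_iff)
    qed
    then have "int p dvd lead_coeff A" by simp
    then have "int p dvd lead_coeff F" unfolding AB lead_coeff_mult by simp
    with F(1) p' show False by simp
  qed
  show ?thesis
  proof (cases "int p dvd coeff A 0 \<and> int p dvd coeff B 0")
    case True
    then have "int p * int p dvd coeff A 0 * coeff B 0" by (intro mult_dvd_mono) auto
    then show ?thesis using F(3) by (simp add: AB coeff_mult power2_eq_square)
  next
    case False
    then show ?thesis using main[of A B] main[of B A] AB nz by (auto simp: mult.commute)
  qed
qed

lemma rat_poly_clear_denominators:
  fixes q :: "rat poly"
  obtains N :: int and Q :: "int poly" where "N > 0" "smult (of_int N) q = map_poly of_int Q"
proof -
  obtain N :: int where N: "N > 0" "\<And>c. c \<in> set (coeffs q) \<Longrightarrow> of_int N * c \<in> \<int>"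
    using common_denominator[of "set (coeffs q)" "\<lambda>c. c"] by blast
  have "of_int N * coeff q i \<in> \<int>" for i
  proof (cases "coeff q i = 0")
    case False
    then have "coeff q i \<in> set (coeffs q)" using range_coeff[of q] by blast
    then show ?thesis by (rule N(2))
  qed simp
  then have "smult (of_int N) q = map_poly of_int (map_poly (\<lambda>c. \<lfloor>of_int N * c\<rfloor>) q)"
    by (intro poly_eqI) (simp add: coeff_map_poly)
  with N(1) that show ?thesis by blast
qed

lemma of_int_poly_mult:
  "map_poly (of_int :: int \<Rightarrow> rat) (P * Q) = map_poly of_int P * map_poly of_int Q"
  by (rule poly_eqI) (simp add: coeff_map_poly coeff_mult)

lemma of_int_poly_eq_iff:
  "map_poly (of_int :: int \<Rightarrow> rat) P = map_poly of_int Q \<longleftrightarrow> P = Q"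
  by (auto simp: poly_eq_iff coeff_map_poly)

text \<open>
  Gauss's lemma: after clearing denominators, replace the factors by their primitive parts, whose
  product is primitive.
\<close>

lemma gauss_int_factorization:
  fixes F :: "int poly" and a b :: "rat poly"
  assumes F: "content F = 1" and ab: "map_poly of_int F = a * b"
  obtains A B where "F = A * B" "degree A = degree a" "degree B = degree b"
proof -
  obtain M P where M: "M > 0" "smult (of_int M) a = map_poly of_int P"
    using rat_poly_clear_denominators by blast
  obtain N Q where N: "N > 0" "smult (of_int N) b = map_poly of_int Q"
    using rat_poly_clear_denominators by blast
  have "map_poly of_int (smult (M * N) F) = smult (of_int M) a * smult (of_int N) b"
    by (simp add: map_poly_smult ab mult.commute)
  then have eq: "smult (M * N) F = P * Q"
    unfolding M N by (simp flip: of_int_poly_mult add: of_int_poly_eq_iff)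
  have "primitive_part P * primitive_part Q = primitive_part (smult (M * N) F)"
    by (simp add: eq primitive_part_mult)
  also have "\<dots> = F"
    using M N F by (simp add: primitive_part_smult primitive_part_prim)
  finally have "F = primitive_part P * primitive_part Q" by simp
  moreover have "degree P = degree a" "degree Q = degree b"
    using arg_cong[OF M(2), of degree] arg_cong[OF N(2), of degree] M(1) N(1)
    by (simp_all add: degree_map_poly)
  ultimately show ?thesis using that by simp
qed

lemma eisenstein_rat:
  fixes F :: "int poly" and p :: nat
  assumes p: "prime p" and F: "lead_coeff F = 1" "degree F > 0"
    "\<And>i. i < degree F \<Longrightarrow> int p dvd coeff F i" "\<not> (int p)\<^sup>2 dvd coeff F 0"
  shows "irreducible (map_poly of_int F :: rat poly)"
proof (rule irreducibleI)
  have deg: "degree (map_poly of_int F :: rat poly) = degree F" by (simp add: degree_map_poly)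
  have "content F dvd 1" using content_dvd_coeff[of F "degree F"] F(1) by simp
  then have content: "content F = 1"
    by (metis is_unit_normalize normalize_content)
  show "map_poly of_int F \<noteq> (0 :: rat poly)" using deg F(2) by auto
  then show "\<not> (map_poly of_int F :: rat poly) dvd 1"
    using deg F(2) by (simp add: is_unit_iff_degree)
  fix a b :: "rat poly" assume ab: "map_poly of_int F = a * b"
  then have "a \<noteq> 0" "b \<noteq> 0" using \<open>map_poly of_int F \<noteq> (0 :: rat poly)\<close> by auto
  moreover obtain A B where AB: "F = A * B" "degree A = degree a" "degree B = degree b"
    using gauss_int_factorization[OF content ab] by blast
  have "degree a = 0 \<or> degree b = 0"
    using eisenstein_int[OF p F(1,3,4) AB(1)] AB by simp
  ultimately show "a dvd 1 \<or> b dvd 1" by (simp add: is_unit_iff_degree)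
qed

text \<open>
  The minimal polynomial of \<open>\<theta> (1 - w)\<close>, where \<open>w\<close> is a primitive fifth root of unity and
  \<open>\<theta>\<^sup>5 = 1/5\<close>. Other rational values of \<open>\<theta>\<^sup>5\<close> also give polynomials of degree \<open>20\<close>; the value \<open>1/5\<close> is chosen
  to make it an Eisenstein polynomial.
\<close>

definition F20 :: "int poly" where
  "F20 = monom 1 20 + monom 25 10 + [:5:]"

lemma degree_F20: "degree F20 = 20"
  unfolding F20_def by (simp add: degree_add_eq_left degree_monom_eq)

lemma irreducible_F20: "irreducible (map_poly of_int F20 :: rat poly)"
proof (rule eisenstein_rat[of 5])
  show "prime (5 :: nat)" by simp
  show "lead_coeff F20 = 1" "degree F20 > 0" unfolding degree_F20 by (simp_all add: F20_def coeff_pCons)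
  show "int 5 dvd coeff F20 i" if "i < degree F20" for i
    using that unfolding degree_F20 by (auto simp: F20_def coeff_pCons split: nat.splits)
  show "\<not> (int 5)\<^sup>2 dvd coeff F20 0" by (simp add: F20_def)
qed

lemma poly_F20:
  "poly (complex_poly (map_poly of_int F20)) z = z ^ 20 + 25 * z ^ 10 + 5"
proof -
  have "complex_poly (map_poly of_int F20) = monom 1 20 + monom 25 10 + [:5:]"
    by (rule poly_eqI) (simp add: F20_def coeff_map_poly coeff_pCons split: nat.splits)
  then show ?thesis by (simp add: poly_monom)
qed

text \<open>
  One has \<open>(1 - w)\<^sup>5 = 5 b\<close> with \<open>b = w\<^sup>4 - 2 w\<^sup>3 + 2 w\<^sup>2 - w\<close>, a number of degree \<open>4\<close> with minimal polynomial
  \<open>x\<^sup>4 + 25 x\<^sup>2 + 5\<close>; and \<open>\<theta>\<close> is normalized so that the fifth power of \<open>\<theta> (1 - w)\<close> is \<open>b\<close> itself.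
\<close>

lemma quintic_F20_root:
  fixes w \<theta> :: complex
  assumes w: "w ^ 4 + w ^ 3 + w ^ 2 + w + 1 = 0" and \<theta>: "5 * \<theta> ^ 5 = 1"
  shows "(\<theta> * (1 - w)) ^ 20 + 25 * (\<theta> * (1 - w)) ^ 10 + 5 = 0"
proof -
  define b where "b = w ^ 4 - 2 * w ^ 3 + 2 * w ^ 2 - w"
  have "w ^ 5 - 1 = (w - 1) * (w ^ 4 + w ^ 3 + w ^ 2 + w + 1)" by algebra
  then have "w ^ 5 = 1" using w by simp
  then have "(1 - w) ^ 5 = 5 * b" unfolding b_def by algebra
  then have "(\<theta> * (1 - w)) ^ 5 = (5 * \<theta> ^ 5) * b" by (simp add: power_mult_distrib)
  then have 1: "(\<theta> * (1 - w)) ^ 5 = b" using \<theta> by simp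
  have "b ^ 4 + 25 * b ^ 2 + 5 = 0" unfolding b_def using w by algebra
  moreover have "(\<theta> * (1 - w)) ^ 20 = b ^ 4" "(\<theta> * (1 - w)) ^ 10 = b ^ 2"
    unfolding 1[symmetric] by (simp_all flip: power_mult)
  ultimately show ?thesis by simp
qed

text \<open>
  The conjugates are the \<open>20\<close> differences of two distinct fifth roots of \<open>1/5\<close>, and the cyclic sum of
  the differences of three such roots vanishes. The three used here are
  \<open>x = \<theta> (1 - w)\<close>, \<open>y = \<theta> (w - w\<^sup>2)\<close> and \<open>z = \<theta> (w\<^sup>2 - 1)\<close>.
\<close>

lemma degree_20_example:
  "\<exists>\<alpha>. algebraic \<alpha> \<and> alg_degree \<alpha> = 20 \<and> three_conjugates_sum_zero \<alpha>"
proof -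
  let ?f = "map_poly of_int F20 :: rat poly"
  define w where "w = cis (2 * pi / 5)"
  have w5: "w ^ 5 = 1" by (simp add: w_def DeMoivre)
  have "w \<noteq> 1"
  proof
    assume "w = 1"
    then have "cos (2 * pi / 5) = cos 0" by (simp add: w_def complex_eq_iff)
    moreover have "cos (2 * pi / 5) < cos 0"
      by (intro cos_monotone_0_pi) auto
    ultimately show False by simp
  qed
  have "(w - 1) * (w ^ 4 + w ^ 3 + w ^ 2 + w + 1) = w ^ 5 - 1" by algebra
  with w5 \<open>w \<noteq> 1\<close> have w: "w ^ 4 + w ^ 3 + w ^ 2 + w + 1 = 0" by simp
  define \<theta> :: complex where "\<theta> = of_real (root 5 (1 / 5))"
  have \<theta>: "5 * \<theta> ^ 5 = 1"
    unfolding \<theta>_def by (simp flip: of_real_power)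
  have w2: "(w ^ 2) ^ 4 + (w ^ 2) ^ 3 + (w ^ 2) ^ 2 + w ^ 2 + 1 = 0" using w by algebra
  define x y z where "x = \<theta> * (1 - w)" and "y = w * x" and "z = - (\<theta> * (1 - w ^ 2))"
  have root_x: "poly (complex_poly ?f) x = 0"
    unfolding poly_F20 x_def by (rule quintic_F20_root[OF w \<theta>])
  have "y ^ 20 = (w ^ 5) ^ 4 * x ^ 20" "y ^ 10 = (w ^ 5) ^ 2 * x ^ 10"
    unfolding y_def power_mult_distrib by (simp_all flip: power_mult)
  then have root_y: "poly (complex_poly ?f) y = 0"
    using root_x unfolding poly_F20 by (simp add: w5)
  have "z ^ 20 = (\<theta> * (1 - w ^ 2)) ^ 20" "z ^ 10 = (\<theta> * (1 - w ^ 2)) ^ 10"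
    by (simp_all add: z_def)
  then have root_z: "poly (complex_poly ?f) z = 0"
    unfolding poly_F20 using quintic_F20_root[OF w2 \<theta>] by simp
  have "?f \<noteq> 0" using irreducible_F20 by auto
  have alg: "algebraic x"
    by (rule algebraicI'[of "complex_poly ?f"])
      (use \<open>?f \<noteq> 0\<close> root_x in \<open>auto simp: coeff_map_poly map_poly_eq_0_iff\<close>)
  have "degree ?f = 20" by (simp add: degree_map_poly degree_F20)
  moreover have "coeff ?f 20 = 1" by (simp add: coeff_map_poly F20_def coeff_pCons)
  ultimately have "lead_coeff ?f = 1" by simp
  then have min: "min_poly_rat x = ?f"
    using the1_equality[OF min_poly_rat_ex1[OF alg]] irreducible_F20 root_x
    unfolding min_poly_rat_def by blast
  have "\<theta> \<noteq> 0" using \<theta> by auto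
  have "x \<noteq> 0" using \<open>\<theta> \<noteq> 0\<close> \<open>w \<noteq> 1\<close> by (simp add: x_def)
  have zx: "z = - (1 + w) * x" by (simp add: x_def z_def algebra_simps power2_eq_square)
  have "x + y + z = 0" by (simp add: zx y_def algebra_simps)
  moreover have "x \<noteq> y" using \<open>x \<noteq> 0\<close> \<open>w \<noteq> 1\<close> by (simp add: y_def)
  moreover have "x \<noteq> z"
  proof
    assume "x = z"
    then have "(2 + w) * x = 0" using zx by (simp add: algebra_simps)
    then have "w = - 2" using \<open>x \<noteq> 0\<close> by (simp add: add_eq_0_iff)
    with w5 show False by simp
  qed
  moreover have "y \<noteq> z"
  proof
    assume "y = z"
    then have "(1 + 2 * w) * x = 0" using zx by (simp add: y_def algebra_simps)
    then have "2 * w = - 1" using \<open>x \<noteq> 0\<close> by (simp add: add_eq_0_iff)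
    then have "(2 * w) ^ 5 = (- 1) ^ 5" by simp
    with w5 show False by (simp add: power_mult_distrib)
  qed
  ultimately have "three_conjugates_sum_zero x"
    unfolding three_conjugates_sum_zero_def alg_conjugates_def min
    using root_x root_y root_z by blast
  moreover have "alg_degree x = 20"
    by (simp add: alg_degree_def min degree_map_poly degree_F20)
  ultimately show ?thesis using alg by blast
qed

section \<open>The smallest degree\<close>

theorem theorem1:
  fixes P :: "nat \<Rightarrow> bool"
  defines "P \<equiv> (\<lambda>d. d > 0 \<and> \<not> 3 dvd d \<and>
    (\<exists>\<alpha>. algebraic \<alpha> \<and> alg_degree \<alpha> = d \<and> three_conjugates_sum_zero \<alpha>))"
  shows "(\<exists>d. P d) \<and> (LEAST d. P d) = 20"
proof -
  have "P 20" using degree_20_example by (simp add: P_def)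
  moreover have "20 \<le> d" if "P d" for d
  proof (rule ccontr)
    assume "\<not> 20 \<le> d"
    then obtain p k where "prime p" "p \<noteq> 3" "d = p ^ k \<or> p > 3 \<and> d = 2 * p ^ k"
      using \<open>P d\<close> small_degree_cases[of d] unfolding P_def by auto
    with degree_restriction \<open>P d\<close> show False unfolding P_def by blast
  qed
  ultimately show ?thesis by (auto intro: Least_equality)
qed

end
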